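(* For every integer $n\ge 5$, the poset $\mathcal{T}_{n-3}$ of totally symmetric plane partitions that fit in an $(n-3)\times(n-3)\times(n-3)$ box, partially ordered by inclusion, is isomorphic to the subposet of $\mathcal{B}(n,n-4)$ obtained by restricting to the elements $[\rho]$ whose deletion $[\rho]\backslash n$ is the commutation class of the lexicographic order on $\binom{[n-1]}{n-4}$.
   Context: A totally symmetric plane partition fitting in an $m\times m\times m$ box is a subset $T\subseteq[m]^3$, where $[m]=\{1,\dots,m\}$, such that $(x_1,x_2,x_3)\in T$ implies $[x_1]\times[x_2]\times[x_3]\subseteq T$, and $(x_{\sigma(1)},x_{\sigma(2)},x_{\sigma(3)})\in T$ for all permutations $\sigma\in\mathfrak{S}_3$. The set of all of these is $\mathcal{T}_m$. Let $\binom{[n]}{k}$ be the set of $k$-element subsets of $[n]$, each written in increasing order. For $X=[x_1<\dots<x_m]$ its packet is $P(X)=\{X\setminus\{x_i\}:1\le i\le m\}$. The lex order is the lexicographic order of increasing sequences and antilex is its reverse. A total order $\rho$ on $\binom{[n]}{k}$ is admissible if for every $X\in\binom{[n]}{k+1}$ the restriction $\rho|_{P(X)}$ is the lex or the antilex order on $P(X)$. $X,Y\in\binom{[n]}{k}$ commute if $P(X)\cap P(Y)=\varnothing$. Two admissible orders (written as sequences) are commutation equivalent if one is obtained from the other by a sequence of transpositions of adjacent commuting elements; $[\rho]$ is the commutation class of $\rho$. The higher Bruhat order $\mathcal{B}(n,k)$ is the set of commutation classes of admissible orders on $\binom{[n]}{k}$, partially ordered by the reflexive-transitive closure of the relations $[\rho]\lessdot[\sigma]$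 holding when there are $\rho'\in[\rho]$, $\sigma'\in[\sigma]$ and $X\in\binom{[n]}{k+1}$ such that the elements of $P(X)$ occur consecutively in $\rho'$ in lex order and $\sigma'$ is obtained from $\rho'$ by reversing this block. For a total order $\rho$ on $\binom{[n]}{k}$, the deletion $\rho\backslash n$ is the restriction of $\rho$ to $\binom{[n-1]}{k}$; for admissible $\rho$ it is admissible, and $[\rho]\backslash n:=[\rho\backslash n]$ is well defined. A subposet carries the induced order. *)

theory Defs
  imports Main
    "HOL-Library.Ramsey"
    "HOL-Library.List_Lexorder"
    "HOL-Combinatorics.Multiset_Permutations"
begin

section \<open>Totally symmetric plane partitions\<close>

definition tspp :: "nat \<Rightarrow> (nat \<times> nat \<times> nat) set set" where
  "tspp m = {T. T \<subseteq> {1..m} \<times> {1..m} \<times> {1..m} \<and>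
     (\<forall>a b c. (a, b, c) \<in> T \<longrightarrow>
        {1..a} \<times> {1..b} \<times> {1..c} \<subseteq> T \<and>
        {(a, c, b), (b, a, c), (b, c, a), (c, a, b), (c, b, a)} \<subseteq> T)}"


section \<open>Admissible orders\<close>

text \<open>A total order on a finite set is represented by the duplicate-free list that enumerates
  the set in increasing order; the set of these lists is \<^const>\<open>permutations_of_set\<close>.
  The set of \<open>k\<close>-element subsets of \<open>{1..n}\<close> is \<^term>\<open>nsets {1..n} k\<close>.\<close>

definition packet :: "nat set \<Rightarrow> nat set set" where
  "packet X = (\<lambda>x. X - {x}) ` X"

text \<open>The lexicographic order on a finite family of finite sets: the increasing sequences of
  the members are sorted by the order on lists from \<^theory>\<open>HOL-Library.List_Lexorder\<close>.\<close>

definition lex_seq :: "nat set set \<Rightarrow> nat set list" where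
  "lex_seq A = map set (sorted_list_of_set (sorted_list_of_set ` A))"

definition seq_restrict :: "'a list \<Rightarrow> 'a set \<Rightarrow> 'a list" where
  "seq_restrict \<rho> A = filter (\<lambda>Y. Y \<in> A) \<rho>"

definition admissible :: "nat \<Rightarrow> nat \<Rightarrow> nat set list set" where
  "admissible n k = {\<rho> \<in> permutations_of_set (nsets {1..n} k).
     \<forall>X \<in> nsets {1..n} (k + 1).
       seq_restrict \<rho> (packet X) = lex_seq (packet X) \<or>
       seq_restrict \<rho> (packet X) = rev (lex_seq (packet X))}"


section \<open>Commutation classes\<close>

definition commute :: "nat set \<Rightarrow> nat set \<Rightarrow> bool" where
  "commute X Y \<longleftrightarrow> packet X \<inter> packet Y = {}"

definition comm_step :: "nat set list rel" where
  "comm_step = {(u @ [X, Y] @ v, u @ [Y, X] @ v) | u v X Y. commute X Y}"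

definition comm_equiv :: "nat \<Rightarrow> nat \<Rightarrow> nat set list rel" where
  "comm_equiv n k = {(\<rho>, \<sigma>). \<rho> \<in> admissible n k \<and> \<sigma> \<in> admissible n k \<and> (\<rho>, \<sigma>) \<in> comm_step\<^sup>*}"

definition comm_class :: "nat \<Rightarrow> nat \<Rightarrow> nat set list \<Rightarrow> nat set list set" where
  "comm_class n k \<rho> = comm_equiv n k `` {\<rho>}"


section \<open>Higher Bruhat orders\<close>

definition higher_bruhat :: "nat \<Rightarrow> nat \<Rightarrow> nat set list set set" where
  "higher_bruhat n k = admissible n k // comm_equiv n k"

definition hb_step :: "nat \<Rightarrow> nat \<Rightarrow> nat set list set rel" where
  "hb_step n k = {(C, D). C \<in> higher_bruhat n k \<and> D \<in> higher_bruhat n k \<and>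
     (\<exists>\<rho> \<in> C. \<exists>\<sigma> \<in> D. \<exists>X \<in> nsets {1..n} (k + 1). \<exists>u v.
        \<rho> = u @ lex_seq (packet X) @ v \<and>
        \<sigma> = u @ rev (lex_seq (packet X)) @ v)}"

text \<open>As a relation on the whole type this also relates every \<open>C\<close> outside
  \<^term>\<open>higher_bruhat n k\<close> to itself; it is only meant to be used on \<^term>\<open>higher_bruhat n k\<close>.\<close>

definition hb_le :: "nat \<Rightarrow> nat \<Rightarrow> nat set list set \<Rightarrow> nat set list set \<Rightarrow> bool" where
  "hb_le n k C D \<longleftrightarrow> (C, D) \<in> (hb_step n k)\<^sup>*"


section \<open>Deletion\<close>

definition deletion :: "nat \<Rightarrow> nat \<Rightarrow> nat set list \<Rightarrow> nat set list" where
  "deletion n k \<rho> = seq_restrict \<rho> (nsets {1..n - 1} k)"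

text \<open>All members of a commutation class contribute the same class to the union; see
  \<open>deletion_class_comm_class\<close> below.\<close>

definition deletion_class :: "nat \<Rightarrow> nat \<Rightarrow> nat set list set \<Rightarrow> nat set list set" where
  "deletion_class n k C = (\<Union>\<rho> \<in> C. comm_class (n - 1) k (deletion n k \<rho>))"

lemma sym_comm_step: "sym comm_step"
proof (rule symI)
  fix \<rho> \<sigma>
  assume "(\<rho>, \<sigma>) \<in> comm_step"
  then obtain u v X Y where "\<rho> = u @ [X, Y] @ v" "\<sigma> = u @ [Y, X] @ v" "commute X Y"
    unfolding comm_step_def by blast
  moreover from this have "commute Y X"
    by (simp add: commute_def Int_commute)
  ultimately show "(\<sigma>, \<rho>) \<in> comm_step"
    unfolding comm_step_def by blast
qed

lemma equiv_comm_equiv: "equiv (admissible n k) (comm_equiv n k)"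
proof (rule equivI)
  show "comm_equiv n k \<subseteq> admissible n k \<times> admissible n k"
    by (auto simp: comm_equiv_def)
  show "refl_on (admissible n k) (comm_equiv n k)"
    by (auto simp: refl_on_def comm_equiv_def)
  show "sym (comm_equiv n k)"
    using sym_rtrancl[OF sym_comm_step] by (auto simp: sym_def comm_equiv_def)
  show "trans (comm_equiv n k)"
    by (auto simp: trans_def comm_equiv_def)
qed

lemma packet_subset_nsets:
  assumes "X \<in> nsets {1..m} (k + 1)"
  shows "packet X \<subseteq> nsets {1..m} k"
  using assms by (auto simp: packet_def nsets_def)

lemma deletion_admissible:
  assumes "\<rho> \<in> admissible n k"
  shows "deletion n k \<rho> \<in> admissible (n - 1) k"
proof -
  have sub: "nsets {1..n - 1} j \<subseteq> nsets {1..n} j" for j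
    by (rule nsets_mono) auto
  have "deletion n k \<rho> \<in> permutations_of_set (nsets {1..n - 1} k)"
    using assms sub[of k]
    by (auto simp: admissible_def deletion_def seq_restrict_def permutations_of_set_def)
  moreover have "seq_restrict (deletion n k \<rho>) (packet X) = seq_restrict \<rho> (packet X)"
    if "X \<in> nsets {1..n - 1} (k + 1)" for X
    unfolding deletion_def seq_restrict_def filter_filter
    by (rule filter_cong) (use packet_subset_nsets[OF that] in auto)
  ultimately show ?thesis
    using assms sub[of "k + 1"] by (auto simp: admissible_def)
qed

lemma comm_step_seq_restrict:
  assumes "(\<rho>, \<sigma>) \<in> comm_step"
  shows "(seq_restrict \<rho> A, seq_restrict \<sigma> A) \<in> comm_step\<^sup>*"
proof -
  from assms obtain u v X Y where uv: "\<rho> = u @ [X, Y] @ v" "\<sigma> = u @ [Y, X] @ v" and "commute X Y"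
    unfolding comm_step_def by blast
  show ?thesis
  proof (cases "X \<in> A \<and> Y \<in> A")
    case True
    then have "seq_restrict \<rho> A = seq_restrict u A @ [X, Y] @ seq_restrict v A"
      "seq_restrict \<sigma> A = seq_restrict u A @ [Y, X] @ seq_restrict v A"
      by (auto simp: uv seq_restrict_def)
    with \<open>commute X Y\<close> show ?thesis
      unfolding comm_step_def by (intro r_into_rtrancl) blast
  next
    case False
    then have "seq_restrict \<rho> A = seq_restrict \<sigma> A"
      by (auto simp: uv seq_restrict_def)
    then show ?thesis by simp
  qed
qed

lemma deletion_comm_equiv:
  assumes "(\<rho>, \<sigma>) \<in> comm_equiv n k"
  shows "(deletion n k \<rho>, deletion n k \<sigma>) \<in> comm_equiv (n - 1) k"
proof -
  have "(seq_restrict \<rho> A, seq_restrict \<sigma> A) \<in> comm_step\<^sup>*" if "(\<rho>, \<sigma>) \<in> comm_step\<^sup>*" for A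
    using that by induction (blast intro: rtrancl_trans comm_step_seq_restrict)+
  with assms show ?thesis
    unfolding comm_equiv_def using deletion_admissible[of _ n k] by (simp add: deletion_def)
qed

lemma deletion_class_comm_class:
  assumes "\<rho> \<in> admissible n k"
  shows "deletion_class n k (comm_class n k \<rho>) = comm_class (n - 1) k (deletion n k \<rho>)"
proof -
  have "(\<lambda>\<rho>. comm_class (n - 1) k (deletion n k \<rho>)) respects comm_equiv n k"
    unfolding comm_class_def
    by (rule congruentI) (metis deletion_comm_equiv equiv_class_eq equiv_comm_equiv)
  from UN_equiv_class[OF equiv_comm_equiv this assms] show ?thesis
    by (simp add: deletion_class_def comm_class_def)
qed


section \<open>Isomorphism of posets\<close>

definition order_isomorphic ::
    "'a set \<Rightarrow> ('a \<Rightarrow> 'a \<Rightarrow> bool) \<Rightarrow> 'b set \<Rightarrow> ('b \<Rightarrow> 'b \<Rightarrow> bool) \<Rightarrow> bool" where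
  "order_isomorphic A le B le' \<longleftrightarrow>
     (\<exists>f. bij_betw f A B \<and> (\<forall>x \<in> A. \<forall>y \<in> A. le x y \<longleftrightarrow> le' (f x) (f y)))"

end

theory Submission
  imports Defs
begin

text \<open>
  A commutation class of admissible orders on the \<open>k\<close>-subsets is determined by its set \<open>U\<close> of inverted
  \<open>(k+1)\<close>-subsets: \<open>U\<close> fixes the relative order of any two \<open>k\<close>-sets that do not commute, and two
  enumerations that agree on these pairs are connected by commutations. The class restricts to the
  lexicographic one on \<open>{1..n-1}\<close> iff all members of \<open>U\<close> contain \<open>n\<close>; then admissibility
  forces \<open>U\<close> to be closed under replacing an element by a larger one. Conversely, every such
  \<open>U\<close> occurs, and every set \<open>X\<close> that can be added to \<open>U\<close> has its packet consecutive in some order of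
  the class, both by induction on \<open>n\<close>. Hence the order of the fibre is inclusion of these sets \<open>U\<close>.
  For \<open>k = n - 4\<close> the complement of a member of \<open>U\<close> is \<open>{a, b+1, c+2}\<close> with
  \<open>1 \<le> a \<le> b \<le> c \<le> n - 3\<close>, and \<open>U\<close> is closed iff these triples form a down-set, that is,
  are the increasing triples of a totally symmetric plane partition.
\<close>

section \<open>Orders with prescribed inversions\<close>

text \<open>Two \<open>k\<close>-sets commute unless they lie in the packet of their union \<open>X\<close>; in that case their
  order is forced by whether \<open>X\<close> belongs to the set \<open>U\<close> of inverted sets.\<close>

definition forced_before :: "nat set set \<Rightarrow> nat set \<Rightarrow> nat set \<Rightarrow> bool" where
  "forced_before U Y Y' \<longleftrightarrow> (\<exists>X x x'. x \<in> X \<and> x' \<in> X \<and> Y = X - {x} \<and> Y' = X - {x'} \<and>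
     (if X \<in> U then x < x' else x' < x))"

text \<open>The negated form leaves pairs that commute free. If the requirements imposed by
  \<open>U\<close> conflict, the set is empty; otherwise it is a whole commutation class, see
  \<open>comm_class_eq_orders\<close>.\<close>

definition orders :: "nat \<Rightarrow> nat \<Rightarrow> nat set set \<Rightarrow> nat set list set" where
  "orders n k U = {\<rho> \<in> permutations_of_set (nsets {1..n} k).
     sorted_wrt (\<lambda>Y Y'. \<not> forced_before U Y' Y) \<rho>}"

text \<open>Exchanges of an element for a larger one generate the componentwise (Gale) order on
  subsets of equal size. \<open>U\<close> may have members outside \<open>{1..n}\<close>, as happens
  when \<open>n + 1\<close> is deleted.\<close>

definition up_closed :: "nat \<Rightarrow> nat set set \<Rightarrow> bool" where
  "up_closed n U \<longleftrightarrow> (\<forall>X \<in> U. X \<subseteq> {1..n} \<longrightarrow>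
     (\<forall>x \<in> X. \<forall>y \<in> {1..n} - X. x < y \<longrightarrow> insert y (X - {x}) \<in> U))"

text \<open>For up-closed \<open>U\<close> and \<open>X \<subseteq> {1..n}\<close>, this holds iff
  \<open>X \<notin> U\<close> and \<open>insert X U\<close> is up-closed again.\<close>

definition addable :: "nat \<Rightarrow> nat set set \<Rightarrow> nat set \<Rightarrow> bool" where
  "addable n U X \<longleftrightarrow> X \<notin> U \<and>
     (\<forall>x \<in> X. \<forall>y \<in> {1..n} - X. x < y \<longrightarrow> insert y (X - {x}) \<in> U)"

text \<open>Removing a larger element leaves a lexicographically smaller set, hence the descending
  order of removal.\<close>

definition lex_packet :: "nat set \<Rightarrow> nat set list" where
  "lex_packet X = map (\<lambda>x. X - {x}) (rev (sorted_list_of_set X))"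

lemma forced_beforeE:
  assumes "forced_before U Y Y'"
  obtains X x x' where "x \<in> X" "x' \<in> X" "Y = X - {x}" "Y' = X - {x'}"
    "X \<in> U \<and> x < x' \<or> X \<notin> U \<and> x' < x"
  using assms unfolding forced_before_def by (metis (full_types))

lemma forced_before_diff:
  assumes "x \<in> X" "x' \<in> X" "X \<in> U \<and> x < x' \<or> X \<notin> U \<and> x' < x"
  shows "forced_before U (X - {x}) (X - {x'})"
  using assms unfolding forced_before_def by (metis (full_types))

lemma ordersD:
  assumes "\<rho> \<in> orders n k U"
  shows "distinct \<rho>" "set \<rho> = nsets {1..n} k" "sorted_wrt (\<lambda>Y Y'. \<not> forced_before U Y' Y) \<rho>"
  using assms by (auto simp: orders_def permutations_of_set_def)

lemma ordersI:
  assumes "distinct \<rho>" "set \<rho> = nsets {1..n} k" "sorted_wrt (\<lambda>Y Y'. \<not> forced_before U Y' Y) \<rho>"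
  shows "\<rho> \<in> orders n k U"
  using assms by (auto simp: orders_def permutations_of_set_def)

lemma set_lex_packet: "finite X \<Longrightarrow> set (lex_packet X) = packet X"
  by (simp add: lex_packet_def packet_def)

lemma distinct_lex_packet: "distinct (lex_packet X)"
  unfolding lex_packet_def
  by (cases "finite X") (auto simp: distinct_map intro!: inj_onI)

text \<open>Two distinct members of the packet have union \<open>X\<close>, so the witness in
  \<open>forced_before\<close> is unique.\<close>

lemma forced_before_packet_iff:
  assumes "x \<in> X" "y \<in> X" "x \<noteq> y"
  shows "forced_before U (X - {x}) (X - {y}) \<longleftrightarrow> (if X \<in> U then x < y else y < x)"
proof
  assume "forced_before U (X - {x}) (X - {y})"
  then obtain Z x' y' where Z: "x' \<in> Z" "y' \<in> Z" "X - {x} = Z - {x'}" "X - {y} = Z - {y'}"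
    "Z \<in> U \<and> x' < y' \<or> Z \<notin> U \<and> y' < x'" by (rule forced_beforeE)
  have "x' \<noteq> y'" using Z(5) by blast
  have "X = (X - {x}) \<union> (X - {y})" using \<open>x \<noteq> y\<close> by auto
  also have "\<dots> = Z" unfolding Z(3,4) using \<open>x' \<noteq> y'\<close> by auto
  finally have "Z = X" by simp
  then have "x' = x" "y' = y" using Z(1-4) assms by blast+
  then show "if X \<in> U then x < y else y < x" using Z(5) \<open>Z = X\<close> by auto
qed (use assms in \<open>auto intro: forced_before_diff split: if_splits\<close>)

lemma sorted_wrt_lex_packet:
  assumes "finite X" "X \<notin> U"
  shows "sorted_wrt (\<lambda>Y Y'. \<not> forced_before U Y' Y) (lex_packet X)"
  unfolding lex_packet_def sorted_wrt_map sorted_wrt_rev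
  by (rule sorted_wrt_mono_rel[OF _ strict_sorted_list_of_set])
    (use assms in \<open>auto simp: forced_before_packet_iff\<close>)

lemma sorted_wrt_rev_lex_packet:
  assumes "finite X" "X \<in> U"
  shows "sorted_wrt (\<lambda>Y Y'. \<not> forced_before U Y' Y) (rev (lex_packet X))"
  unfolding lex_packet_def rev_map rev_rev_ident sorted_wrt_map
  by (rule sorted_wrt_mono_rel[OF _ strict_sorted_list_of_set])
    (use assms in \<open>auto simp: forced_before_packet_iff\<close>)

lemma forced_before_irrefl: "\<not> forced_before U Y Y"
  by (auto elim!: forced_beforeE)

section \<open>Deletion and contraction of the largest element\<close>

lemma up_closedD:
  assumes "up_closed n U" "X \<in> U" "X \<subseteq> {1..n}" "x \<in> X" "y \<in> {1..n}" "y \<notin> X" "x < y"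
  shows "insert y (X - {x}) \<in> U"
  using assms unfolding up_closed_def by blast

lemma up_closed_deletion: "up_closed (Suc n) U \<Longrightarrow> up_closed n U"
  unfolding up_closed_def by fastforce

lemma up_closed_contraction:
  assumes "up_closed (Suc n) U"
  shows "up_closed n {X. insert (Suc n) X \<in> U}"
  unfolding up_closed_def
proof (intro ballI impI, unfold mem_Collect_eq)
  fix X x y assume X: "insert (Suc n) X \<in> U" "X \<subseteq> {1..n}" "x \<in> X" "y \<in> {1..n} - X" "x < y"
  then have "insert y (insert (Suc n) X - {x}) \<in> U"
    by (intro up_closedD[OF assms]) auto
  moreover have "insert y (insert (Suc n) X - {x}) = insert (Suc n) (insert y (X - {x}))"
    using X by auto
  ultimately show "insert (Suc n) (insert y (X - {x})) \<in> U" by simp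
qed

lemma addable_deletion: "addable (Suc n) U X \<Longrightarrow> addable n U X"
  unfolding addable_def by fastforce

lemma addable_contraction:
  assumes "addable (Suc n) U (insert (Suc n) X)" "X \<subseteq> {1..n}"
  shows "addable n {X. insert (Suc n) X \<in> U} X"
  unfolding addable_def
proof (intro conjI ballI impI, unfold mem_Collect_eq)
  show "insert (Suc n) X \<notin> U" using assms by (simp add: addable_def)
  fix x y assume X: "x \<in> X" "y \<in> {1..n} - X" "x < y"
  then have "insert y (insert (Suc n) X - {x}) \<in> U"
    using assms unfolding addable_def by auto
  moreover have "insert y (insert (Suc n) X - {x}) = insert (Suc n) (insert y (X - {x}))"
    using X assms by auto
  ultimately show "insert (Suc n) (insert y (X - {x})) \<in> U" by simp
qed

lemma nsets_Suc_Suc: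
  "nsets {1..Suc n} (Suc k) = nsets {1..n} (Suc k) \<union> insert (Suc n) ` nsets {1..n} k"
proof (intro equalityI subsetI)
  fix X assume X: "X \<in> nsets {1..Suc n} (Suc k)"
  show "X \<in> nsets {1..n} (Suc k) \<union> insert (Suc n) ` nsets {1..n} k"
  proof (cases "Suc n \<in> X")
    case True
    with X have "X - {Suc n} \<in> nsets {1..n} k" by (auto simp: nsets_def)
    with True show ?thesis by (metis UnI2 image_eqI insert_Diff)
  next
    case False
    have "X \<subseteq> {1..n}"
    proof
      fix x assume "x \<in> X"
      with X False have "x \<in> {1..Suc n}" "x \<noteq> Suc n" by (auto simp: nsets_def)
      then show "x \<in> {1..n}" by auto
    qed
    with X show ?thesis by (auto simp: nsets_def)
  qed
next
  fix X assume "X \<in> nsets {1..n} (Suc k) \<union> insert (Suc n) ` nsets {1..n} k"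
  then show "X \<in> nsets {1..Suc n} (Suc k)"
    by (auto simp: nsets_def card_insert_if)
qed

lemma nsetsD: "X \<in> nsets A k \<Longrightarrow> X \<subseteq> A" "X \<in> nsets A k \<Longrightarrow> finite X" "X \<in> nsets A k \<Longrightarrow> card X = k"
  by (auto simp: nsets_def)

text \<open>The witness \<open>X\<close> contains \<open>m\<close>, which is neither of the removed
  elements; taking \<open>m\<close> out of all three sets keeps the comparison.\<close>

lemma forced_before_insertD:
  assumes "m \<notin> Y" "m \<notin> Y'" "Y \<noteq> Y'"
    and f: "forced_before U (insert m Y) (insert m Y')"
  shows "forced_before {X. insert m X \<in> U} Y Y'"
proof -
  from f obtain X x x' where X: "x \<in> X" "x' \<in> X" "insert m Y = X - {x}" "insert m Y' = X - {x'}"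
    "X \<in> U \<and> x < x' \<or> X \<notin> U \<and> x' < x" by (rule forced_beforeE)
  from X have m: "m \<in> X" "x \<noteq> m" "x' \<noteq> m" by auto
  have "Y = (X - {m}) - {x}" "Y' = (X - {m}) - {x'}" using X assms by auto
  moreover have "insert m (X - {m}) = X" using m by auto
  ultimately show ?thesis using X m forced_before_diff[of x "X - {m}" x' "{X. insert m X \<in> U}"] by auto
qed

text \<open>Deleting and contracting the largest element \<open>n + 1\<close>: the sets containing \<open>n + 1\<close> fit
  between the sets \<open>Y\<close> avoiding it with \<open>Y \<union> {n + 1} \<notin> U\<close> and those with \<open>Y \<union> {n + 1} \<in> U\<close>.\<close>

lemma orders_Suc_Suc:
  assumes up: "up_closed (Suc n) U"
    and L1: "L1 \<in> orders n (Suc k) U"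
    and L2: "L2 \<in> orders n k {X. insert (Suc n) X \<in> U}"
  shows "filter (\<lambda>Y. insert (Suc n) Y \<notin> U) L1 @ map (insert (Suc n)) L2 @
    filter (\<lambda>Y. insert (Suc n) Y \<in> U) L1 \<in> orders (Suc n) (Suc k) U"
    (is "?F @ ?M @ ?G \<in> _")
proof (rule ordersI)
  note 1 = ordersD[OF L1] and 2 = ordersD[OF L2]
  have s1: "m \<notin> Y" "Y \<subseteq> {1..n}" if "Y \<in> set L1" "m > n" for Y m
    using that 1(2) by (auto simp: nsets_def)
  have s2: "m \<notin> Y" "Y \<subseteq> {1..n}" if "Y \<in> set L2" "m > n" for Y m
    using that 2(2) by (auto simp: nsets_def)
  have inj: "inj_on (insert (Suc n)) (set L2)"
    using s2(1)[of _ "Suc n"] by (intro inj_onI) (metis insert_ident lessI)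
  show "set (?F @ ?M @ ?G) = nsets {1..Suc n} (Suc k)"
    unfolding nsets_Suc_Suc 1(2)[symmetric] 2(2)[symmetric] by auto
  have "set ?M \<inter> set L1 = {}" using s1(1)[of _ "Suc n"] by auto
  moreover have "distinct ?M" using 2(1) inj by (simp add: distinct_map)
  ultimately show "distinct (?F @ ?M @ ?G)" using 1(1) by auto
  have "sorted_wrt (\<lambda>Y Y'. \<not> forced_before U (insert (Suc n) Y') (insert (Suc n) Y)) L2"
  proof (rule sorted_wrt_mono_rel[OF _ 2(3)])
    fix Y Y' assume "Y \<in> set L2" "Y' \<in> set L2"
      "\<not> forced_before {X. insert (Suc n) X \<in> U} Y' Y"
    then show "\<not> forced_before U (insert (Suc n) Y') (insert (Suc n) Y)"
      using forced_before_insertD[of "Suc n" Y' Y U] s2(1)[of _ "Suc n"] forced_before_irrefl by blast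
  qed
  moreover have "sorted_wrt (\<lambda>Y Y'. \<not> forced_before U Y' Y) ?F"
    "sorted_wrt (\<lambda>Y Y'. \<not> forced_before U Y' Y) ?G"
    using 1(3) by (auto simp: sorted_wrt_filter)
  \<comment> \<open>Only \<open>insert (Suc n) Y\<close> can compare \<open>Y\<close> with a set
    containing \<open>n + 1\<close>. Outside \<open>U\<close> it puts \<open>Y\<close> first; in the
    next claim, inside \<open>U\<close>, it puts \<open>Y\<close> last.\<close>
  moreover have "\<not> forced_before U (insert (Suc n) W) Y"
    if "Y \<in> set L1" "insert (Suc n) Y \<notin> U" "W \<in> set L2" for Y W
  proof
    assume "forced_before U (insert (Suc n) W) Y"
    then obtain X x x' where X: "x \<in> X" "x' \<in> X" "insert (Suc n) W = X - {x}" "Y = X - {x'}"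
      "X \<in> U \<and> x < x' \<or> X \<notin> U \<and> x' < x" by (rule forced_beforeE)
    have "x' = Suc n" using X(3,4) s1(1)[OF that(1)] by auto
    then have "X = insert (Suc n) Y" using X by blast
    then have "X \<notin> U" using that(2) by simp
    then have "Suc n < x" using X(5) \<open>x' = Suc n\<close> by simp
    have "x \<in> Y" using X(1) \<open>X = insert (Suc n) Y\<close> \<open>Suc n < x\<close> by simp
    then show False using s1(2)[OF that(1)] \<open>Suc n < x\<close> by fastforce
  qed
  moreover have "\<not> forced_before U Y (insert (Suc n) W)"
    if "Y \<in> set L1" "insert (Suc n) Y \<in> U" "W \<in> set L2" for Y W
  proof
    assume "forced_before U Y (insert (Suc n) W)"
    then obtain X x x' where X: "x \<in> X" "x' \<in> X" "Y = X - {x}" "insert (Suc n) W = X - {x'}"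
      "X \<in> U \<and> x < x' \<or> X \<notin> U \<and> x' < x" by (rule forced_beforeE)
    have "x = Suc n" using X(3,4) s1(1)[OF that(1)] by auto
    then have "X = insert (Suc n) Y" using X by blast
    then have "X \<in> U" using that(2) by simp
    then have "Suc n < x'" using X(5) \<open>x = Suc n\<close> by simp
    have "x' \<in> Y" using X(2) \<open>X = insert (Suc n) Y\<close> \<open>Suc n < x'\<close> by simp
    then show False using s1(2)[OF that(1)] \<open>Suc n < x'\<close> by fastforce
  qed
  \<comment> \<open>This is where up-closure enters. If \<open>Z\<close> had to precede
    \<open>Y\<close>, then \<open>insert (Suc n) Y\<close> would be in \<open>U\<close>: exchange
    \<open>y\<close> for \<open>n + 1\<close> in \<open>X\<close> if \<open>X \<in> U\<close>, and
    \<open>y\<close> for \<open>z\<close> in \<open>insert (Suc n) Z\<close> otherwise.\<close>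
  moreover have "\<not> forced_before U Z Y"
    if "Y \<in> set L1" "insert (Suc n) Y \<notin> U" "Z \<in> set L1" "insert (Suc n) Z \<in> U" for Y Z
  proof
    assume "forced_before U Z Y"
    then obtain X z y where X: "z \<in> X" "y \<in> X" "Z = X - {z}" "Y = X - {y}"
      "X \<in> U \<and> z < y \<or> X \<notin> U \<and> y < z" by (rule forced_beforeE)
    have "z \<noteq> y" using X(5) by blast
    then have "y \<in> Z" "z \<in> Y" using X(1-4) by auto
    moreover have "Y \<subseteq> {1..n}" "Z \<subseteq> {1..n}" using s1(2) that by blast+
    ultimately have yz: "y \<in> {1..n}" "z \<in> {1..n}" by blast+
    have XX: "X \<subseteq> {1..n}" using \<open>Z \<subseteq> {1..n}\<close> \<open>Z = X - {z}\<close> yz by blast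
    have Y: "insert (Suc n) (X - {y}) = insert (Suc n) Y" using X by simp
    from X(5) show False
    proof
      assume *: "X \<in> U \<and> z < y"
      have "insert (Suc n) (X - {y}) \<in> U"
      proof (rule up_closedD[OF up])
        show "X \<subseteq> {1..Suc n}" using XX by fastforce
        show "Suc n \<notin> X" using XX by fastforce
      qed (use * yz \<open>y \<in> X\<close> in auto)
      then show False using that Y by simp
    next
      assume *: "X \<notin> U \<and> y < z"
      have "insert z (insert (Suc n) Z - {y}) \<in> U"
      proof (rule up_closedD[OF up])
        show "insert (Suc n) Z \<in> U" by fact
        show "insert (Suc n) Z \<subseteq> {1..Suc n}" using s1(2)[OF that(3)] by fastforce
        show "z \<notin> insert (Suc n) Z" using yz \<open>Z = X - {z}\<close> by simp
      qed (use * yz \<open>y \<in> Z\<close> in auto)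
      moreover have "insert z (insert (Suc n) Z - {y}) = insert (Suc n) Y"
        using \<open>Y = X - {y}\<close> \<open>Z = X - {z}\<close> X(1) yz \<open>z \<noteq> y\<close> by auto
      ultimately show False using that by simp
    qed
  qed
  ultimately show "sorted_wrt (\<lambda>Y Y'. \<not> forced_before U Y' Y) (?F @ ?M @ ?G)"
    by (auto simp: sorted_wrt_append sorted_wrt_map)
qed

section \<open>Existence of orders\<close>

lemma orders_0: "[{}] \<in> orders n 0 U"
  by (rule ordersI) (auto simp: nsets_def)

text \<open>Induction on \<open>n\<close>: the deletion orders the sets avoiding
  \<open>n + 1\<close>, the contraction those containing it, and \<open>orders_Suc_Suc\<close> joins
  them. The contraction changes both \<open>k\<close> and \<open>U\<close>, so they vary in the
  induction.\<close>

lemma orders_nonempty: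
  assumes "up_closed n U"
  shows "\<exists>L. L \<in> orders n k U"
  using assms
proof (induction n arbitrary: k U)
  case 0
  have "[] \<in> orders 0 (Suc k') U" for k'
    by (rule ordersI) (auto simp: nsets_def)
  then show ?case using orders_0 by (cases k) auto
next
  case (Suc n)
  show ?case
  proof (cases k)
    case 0
    then show ?thesis using orders_0 by auto
  next
    case (Suc k')
    then show ?thesis
      using orders_Suc_Suc[OF Suc.prems] Suc.IH[OF up_closed_deletion[OF Suc.prems]]
        Suc.IH[OF up_closed_contraction[OF Suc.prems]] by blast
  qed
qed

section \<open>Consecutive packets and their reversal\<close>

lemma sorted_list_of_set_insert_greatest:
  assumes "finite X" "\<And>x. x \<in> X \<Longrightarrow> x < (m::nat)"
  shows "sorted_list_of_set (insert m X) = sorted_list_of_set X @ [m]"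
proof -
  have "m \<notin> X" using assms by blast
  then have "sorted_list_of_set (insert m X) = insort m (sorted_list_of_set X)"
    using assms(1) by (rule sorted_list_of_set_insert[rotated])
  also have "\<dots> = sorted_list_of_set X @ [m]"
    using assms by (intro sorted_insort_is_snoc) (auto simp: less_imp_le)
  finally show ?thesis .
qed

text \<open>The first set omits \<open>m\<close>; all others keep it and come from the
  contraction.\<close>

lemma lex_packet_insert_greatest:
  assumes "finite X" "\<And>x. x \<in> X \<Longrightarrow> x < m"
  shows "lex_packet (insert m X) = X # map (insert m) (lex_packet X)"
proof -
  have "m \<notin> X" using assms by blast
  moreover have "insert m X - {x} = insert m (X - {x})" if "x \<in> X" for x
    using assms(2)[OF that] by auto
  moreover have "sorted_list_of_set (insert m X) = sorted_list_of_set X @ [m]"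
    using assms by (rule sorted_list_of_set_insert_greatest)
  ultimately show ?thesis
    unfolding lex_packet_def by (simp del: sorted_list_of_set_insert_remove add: assms(1))
qed

text \<open>Induction as in \<open>orders_nonempty\<close>. If \<open>n + 1 \<in> X\<close>, then \<open>X - {n + 1}\<close> can be moved to
  the end of the first block and from there to the rest of the packet of \<open>X\<close>: it is not comparable
  to a set that contains \<open>n + 1\<close> and lies outside this packet. If \<open>n + 1 \<notin> X\<close>, then the whole
  packet lies in the last block.\<close>

lemma ex_order_with_lex_packet:
  assumes "up_closed n U" "addable n U X" "X \<in> nsets {1..n} (Suc k)"
  shows "\<exists>u v. u @ lex_packet X @ v \<in> orders n k U"
  using assms
proof (induction n arbitrary: k U X)
  case 0
  then show ?case by (auto simp: nsets_def)
next
  case (Suc n)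
  note up = \<open>up_closed (Suc n) U\<close> and add = \<open>addable (Suc n) U X\<close> and X = \<open>X \<in> nsets {1..Suc n} (Suc k)\<close>
  have finX: "finite X" using X by (rule nsetsD)
  show ?case
  proof (cases k)
    case 0
    with X have "card X = 1" by (simp add: nsets_def)
    then obtain x where "X = {x}" by (rule card_1_singletonE)
    then have "lex_packet X = [{}]" by (simp add: lex_packet_def)
    then have "[] @ lex_packet X @ [] \<in> orders (Suc n) k U" using orders_0 0 by simp
    then show ?thesis by blast
  next
    case (Suc k')
    show ?thesis
    proof (cases "Suc n \<in> X")
      case True
      define X1 where "X1 = X - {Suc n}"
      have X1: "X = insert (Suc n) X1" "Suc n \<notin> X1" "X1 \<subseteq> {1..n}" "finite X1"
        using X True by (auto simp: X1_def nsets_def)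
      have X1k: "X1 \<in> nsets {1..n} (Suc k')"
        using X X1 Suc by (auto simp: nsets_def)
      define U' where "U' = {X. insert (Suc n) X \<in> U}"
      \<comment> \<open>In the contraction the packet of \<open>X1\<close> is consecutive; adding
        \<open>n + 1\<close> to its members gives the packet of \<open>X\<close> without
        \<open>X1\<close>.\<close>
      obtain u v where uv: "u @ lex_packet X1 @ v \<in> orders n k' U'"
        using Suc.IH[OF up_closed_contraction[OF up] addable_contraction X1k] add X1
        unfolding U'_def by blast
      obtain L where L: "L \<in> orders n (Suc k') U"
        using orders_nonempty up_closed_deletion up by blast
      note Ld = ordersD[OF L]
      have "X1 \<in> set L" using Ld X1k by simp
      then obtain a b where ab: "L = a @ X1 # b" by (meson split_list)
      let ?P = "\<lambda>Y. insert (Suc n) Y \<notin> U" and ?Q = "\<lambda>Y. insert (Suc n) Y \<in> U"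
      have "X \<notin> U" using add by (simp add: addable_def)
      then have PX1: "?P X1" using X1 by simp
      let ?M = "map (insert (Suc n))"
      have old: "filter ?P a @ X1 # filter ?P b @ ?M u @ ?M (lex_packet X1) @ ?M v @ filter ?Q L
          \<in> orders (Suc n) k U"
        using orders_Suc_Suc[OF up L uv[unfolded U'_def]] PX1 unfolding ab Suc by simp
      note old' = ordersD[OF old]
      have lexX: "lex_packet X = X1 # ?M (lex_packet X1)"
        unfolding X1(1) using X1 by (intro lex_packet_insert_greatest) auto
      \<comment> \<open>Otherwise \<open>insert (Suc n) Y \<in> U\<close>: exchange \<open>y\<close>
        for \<open>n + 1\<close> in \<open>Z\<close> if \<open>Z \<in> U\<close>, and use addability
        of \<open>X\<close> with \<open>y\<close> exchanged for \<open>x\<close> if not.\<close>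
      have no1: "\<not> forced_before U X1 Y" if "Y \<in> set b" "?P Y" for Y
      proof
        assume "forced_before U X1 Y"
        then obtain Z x y where Z: "x \<in> Z" "y \<in> Z" "X1 = Z - {x}" "Y = Z - {y}"
          "Z \<in> U \<and> x < y \<or> Z \<notin> U \<and> y < x" by (rule forced_beforeE)
        have "x \<noteq> y" using Z(5) by blast
        then have "x \<in> Y" "y \<in> X1" using Z(1-4) by auto
        moreover have "Y \<in> nsets {1..n} (Suc k')" using that unfolding Ld(2)[symmetric] ab by simp
        then have Yn: "Y \<subseteq> {1..n}" by (rule nsetsD)
        ultimately have xy: "x \<in> {1..n}" "y \<in> {1..n}" using X1 by auto
        have Zn: "Z \<subseteq> {1..n}" using Yn \<open>Y = Z - {y}\<close> xy by blast
        from Z(5) show False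
        proof
          assume *: "Z \<in> U \<and> x < y"
          have "insert (Suc n) (Z - {y}) \<in> U"
          proof (rule up_closedD[OF up])
            show "Z \<subseteq> {1..Suc n}" using Zn by fastforce
            show "Suc n \<notin> Z" using Zn by fastforce
          qed (use * xy \<open>y \<in> Z\<close> in auto)
          then show False using that Z(4) by simp
        next
          assume *: "Z \<notin> U \<and> y < x"
          have "insert x (X - {y}) \<in> U"
            using add * xy \<open>y \<in> X1\<close> X1(1) \<open>X1 = Z - {x}\<close> unfolding addable_def by auto
          moreover have "insert x (X - {y}) = insert (Suc n) Y"
            using \<open>Y = Z - {y}\<close> \<open>X1 = Z - {x}\<close> Z(1) xy \<open>x \<noteq> y\<close> X1(1) by auto
          ultimately show False using that by simp
        qed
      qed
      \<comment> \<open>The witness would have to be \<open>X\<close>, which puts \<open>W\<close>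
        into the packet of \<open>X1\<close>; that packet is disjoint from \<open>u\<close>.\<close>
      have no2: "\<not> forced_before U X1 (insert (Suc n) W)" if "W \<in> set u" for W
      proof
        assume "forced_before U X1 (insert (Suc n) W)"
        then obtain Z x y where Z: "x \<in> Z" "y \<in> Z" "X1 = Z - {x}" "insert (Suc n) W = Z - {y}"
          "Z \<in> U \<and> x < y \<or> Z \<notin> U \<and> y < x" by (rule forced_beforeE)
        have "W \<in> nsets {1..n} k'" using that unfolding ordersD(2)[OF uv, symmetric] by simp
        then have W: "W \<subseteq> {1..n}" by (rule nsetsD)
        have "x = Suc n" using Z(3,4) X1(2) by blast
        then have "Z = insert (Suc n) X1" using Z by blast
        have "y \<noteq> Suc n" using Z(4) by blast
        then have "y \<in> X1" using Z(2) \<open>Z = insert (Suc n) X1\<close> by simp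
        have "Suc n \<notin> W" using W by fastforce
        moreover have "insert (Suc n) W = insert (Suc n) (X1 - {y})"
          unfolding Z(4) \<open>Z = insert (Suc n) X1\<close> using \<open>y \<noteq> Suc n\<close> by blast
        ultimately have "W = X1 - {y}" using X1(2) by (meson Diff_iff insert_ident)
        then have "W \<in> set (lex_packet X1)"
          using \<open>y \<in> X1\<close> X1(4) by (simp add: set_lex_packet packet_def)
        then show False using that ordersD(1)[OF uv] by auto
      qed
      have "(filter ?P a @ filter ?P b @ ?M u) @ lex_packet X @ (?M v @ filter ?Q L) \<in> orders (Suc n) k U"
      proof (rule ordersI)
        show "sorted_wrt (\<lambda>Y Y'. \<not> forced_before U Y' Y)
          ((filter ?P a @ filter ?P b @ ?M u) @ lex_packet X @ (?M v @ filter ?Q L))"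
          using old'(3) no1 no2 unfolding lexX by (auto simp add: sorted_wrt_append)
      qed (use old'(1,2) lexX in auto)
      then show ?thesis by blast
    next
      case False
      have "X \<subseteq> {1..n}"
      proof
        fix x assume "x \<in> X"
        with X False have "x \<in> {1..Suc n}" "x \<noteq> Suc n" by (auto simp: nsets_def)
        then show "x \<in> {1..n}" by auto
      qed
      with X have Xn: "X \<in> nsets {1..n} (Suc (Suc k'))" by (simp add: nsets_def Suc)
      obtain u v where uv: "u @ lex_packet X @ v \<in> orders n (Suc k') U"
        using Suc.IH[OF up_closed_deletion[OF up] addable_deletion[OF add] Xn] by blast
      obtain L where L: "L \<in> orders n k' {X. insert (Suc n) X \<in> U}"
        using orders_nonempty up_closed_contraction up by blast
      let ?Q = "\<lambda>Y. insert (Suc n) Y \<in> U"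
      \<comment> \<open>Adding \<open>n + 1\<close> to \<open>X - {x}\<close> exchanges
        \<open>x\<close> for a larger element, so addability applies.\<close>
      have "?Q (X - {x})" if "x \<in> X" for x
        using add that False \<open>X \<subseteq> {1..n}\<close> unfolding addable_def by fastforce
      then have "\<forall>Y \<in> set (lex_packet X). ?Q Y"
        using finX by (auto simp: set_lex_packet packet_def)
      then have "filter ?Q (lex_packet X) = lex_packet X" by simp
      then have "filter ?Q (u @ lex_packet X @ v) = filter ?Q u @ lex_packet X @ filter ?Q v" by simp
      then have "(filter (\<lambda>Y. \<not> ?Q Y) (u @ lex_packet X @ v) @ map (insert (Suc n)) L @ filter ?Q u) @
          lex_packet X @ filter ?Q v \<in> orders (Suc n) k U"
        using orders_Suc_Suc[OF up uv L] unfolding Suc append_assoc by (simp only:)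
      then show ?thesis by blast
    qed
  qed
qed

text \<open>For \<open>X' \<noteq> X\<close> the packets of \<open>X\<close> and \<open>X'\<close> share at most one set.\<close>

lemma orders_reverse_packet:
  assumes L: "u @ lex_packet X @ v \<in> orders n k U" and "finite X" "X \<notin> U"
  shows "u @ rev (lex_packet X) @ v \<in> orders n k (insert X U)"
proof (rule ordersI)
  note Ld = ordersD[OF L]
  let ?R = "\<lambda>Y Y'. \<not> forced_before U Y' Y" and ?S = "\<lambda>Y Y'. \<not> forced_before (insert X U) Y' Y"
  \<comment> \<open>A pair not contained in the packet of \<open>X\<close> has a witness other than
    \<open>X\<close>, whose membership does not change.\<close>
  have imp: "?S Y Y'" if "?R Y Y'" "Y \<notin> packet X \<or> Y' \<notin> packet X" for Y Y'
  proof
    assume "forced_before (insert X U) Y' Y"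
    then obtain Z x y where Z: "x \<in> Z" "y \<in> Z" "Y' = Z - {x}" "Y = Z - {y}"
      "Z \<in> insert X U \<and> x < y \<or> Z \<notin> insert X U \<and> y < x" by (rule forced_beforeE)
    with that(2) have "Z \<noteq> X" by (auto simp: packet_def)
    then show False using Z that(1) forced_before_diff[of x Z y U] by auto
  qed
  have disj: "Y \<notin> packet X" if "Y \<in> set u \<or> Y \<in> set v" for Y
    using that Ld(1) set_lex_packet[OF \<open>finite X\<close>] by auto
  have "sorted_wrt ?S (rev (lex_packet X))"
    using \<open>finite X\<close> by (rule sorted_wrt_rev_lex_packet) simp
  moreover have "sorted_wrt ?S u" "sorted_wrt ?S v"
    using Ld(3) imp disj unfolding sorted_wrt_append
    by (blast intro: sorted_wrt_mono_rel[of _ ?R ?S])+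
  ultimately show "sorted_wrt ?S (u @ rev (lex_packet X) @ v)"
    using Ld(3) imp disj set_lex_packet[OF \<open>finite X\<close>] unfolding sorted_wrt_append set_append set_rev
    by (metis Un_iff)
  show "distinct (u @ rev (lex_packet X) @ v)" "set (u @ rev (lex_packet X) @ v) = nsets {1..n} k"
    using Ld(1,2) by auto
qed

section \<open>Commutation classes and inversion sets\<close>

text \<open>Exposes two entries by splitting the list, a form that is compatible with restriction to
  a packet.\<close>

lemma sorted_wrt_iff_split:
  "sorted_wrt P L \<longleftrightarrow> (\<forall>u x v y w. L = u @ x # v @ y # w \<longrightarrow> P x y)"
proof
  assume *: "\<forall>u x v y w. L = u @ x # v @ y # w \<longrightarrow> P x y"
  then show "sorted_wrt P L"
  proof (induction L)
    case (Cons a L)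
    have "P a y" if "y \<in> set L" for y
    proof -
      from that obtain v w where "L = v @ y # w" by (meson split_list)
      then have "a # L = [] @ a # v @ y # w" by simp
      then show ?thesis using Cons.prems by blast
    qed
    moreover have "sorted_wrt P L"
      using Cons.prems by (intro Cons.IH) (metis append_Cons)
    ultimately show ?case by simp
  qed simp
qed (auto simp: sorted_wrt_append)

section \<open>Connectedness by commutations\<close>

lemma comm_step_Cons:
  assumes "(\<rho>, \<sigma>) \<in> comm_step\<^sup>*"
  shows "(a # \<rho>, a # \<sigma>) \<in> comm_step\<^sup>*"
  using assms
proof induction
  case (step \<sigma> \<tau>)
  from step.hyps(2) have "(a # \<sigma>, a # \<tau>) \<in> comm_step"
    unfolding comm_step_def by clarsimp (metis append_Cons)
  with step.IH show ?case by (rule rtrancl_into_rtrancl)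
qed simp

text \<open>The first entry of \<open>\<sigma>\<close> commutes with everything that precedes it in \<open>\<rho>\<close>.\<close>

lemma sorted_wrt_imp_comm_step:
  assumes "sorted_wrt R \<rho>" "sorted_wrt R \<sigma>" "distinct \<rho>" "distinct \<sigma>" "set \<rho> = set \<sigma>"
    and "\<And>X Y. X \<in> set \<sigma> \<Longrightarrow> Y \<in> set \<sigma> \<Longrightarrow> X \<noteq> Y \<Longrightarrow> R X Y \<Longrightarrow> R Y X \<Longrightarrow> commute X Y"
  shows "(\<rho>, \<sigma>) \<in> comm_step\<^sup>*"
  using assms
proof (induction \<sigma> arbitrary: \<rho>)
  case (Cons a \<sigma>)
  then obtain u v where \<rho>: "\<rho> = u @ a # v" by (metis list.set_intros(1) split_list)
  have "commute X a" if "X \<in> set u" for X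
  proof (rule Cons.prems(6))
    have "X \<noteq> a" using that Cons.prems(3) unfolding \<rho> by auto
    with that Cons.prems(5) have "X \<in> set \<sigma>" unfolding \<rho> by auto
    then show "R a X" "X \<in> set (a # \<sigma>)" using Cons.prems(2) by auto
    show "R X a" using that Cons.prems(1) unfolding \<rho> by (simp add: sorted_wrt_append)
    show "X \<noteq> a" by fact
  qed simp
  \<comment> \<open>Move \<open>a\<close> to the front past the entries of \<open>u\<close>, the
    last one first.\<close>
  then have "(u @ a # v, a # u @ v) \<in> comm_step\<^sup>*"
  proof (induction u arbitrary: v rule: rev_induct)
    case (snoc X u)
    then have "commute X a" and IH: "(u @ a # X # v, a # u @ X # v) \<in> comm_step\<^sup>*"
      by auto
    from \<open>commute X a\<close> have "(u @ [X, a] @ v, u @ [a, X] @ v) \<in> comm_step"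
      unfolding comm_step_def by blast
    with IH show ?case by (simp add: converse_rtrancl_into_rtrancl)
  qed simp
  moreover have "(u @ v, \<sigma>) \<in> comm_step\<^sup>*"
  proof (rule Cons.IH)
    show "set (u @ v) = set \<sigma>" using Cons.prems(3-5) unfolding \<rho> by auto
  qed (use Cons.prems in \<open>auto simp: \<rho> sorted_wrt_append\<close>)
  then have "(a # u @ v, a # \<sigma>) \<in> comm_step\<^sup>*"
    by (rule comm_step_Cons)
  ultimately show ?case unfolding \<rho> by (rule rtrancl_trans)
qed simp

text \<open>If the packets meet, \<open>Y'\<close> arises from \<open>Y\<close> by exchanging some
  \<open>y\<close> for \<open>y'\<close>. Both lie in the packet of \<open>insert y' Y\<close>, and
  this set forces one of the two orders whether or not it is in \<open>U\<close>.\<close>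

lemma commute_or_forced_before:
  assumes "Y \<noteq> Y'"
  shows "commute Y Y' \<or> forced_before U Y Y' \<or> forced_before U Y' Y"
proof (rule disjCI)
  assume *: "\<not> (forced_before U Y Y' \<or> forced_before U Y' Y)"
  show "commute Y Y'"
    unfolding commute_def packet_def
  proof (rule equals0I)
    fix Z assume "Z \<in> (\<lambda>x. Y - {x}) ` Y \<inter> (\<lambda>x. Y' - {x}) ` Y'"
    then obtain y y' where y: "y \<in> Y" "y' \<in> Y'" "Y - {y} = Y' - {y'}" by auto
    have "y \<notin> Y'" "y' \<notin> Y" using y assms by blast+
    then have "Y = insert y' Y - {y'}" "Y' = insert y' Y - {y}" "y \<noteq> y'" using y by auto
    then show False
      using * y(1) forced_before_diff[of y' "insert y' Y" y U] forced_before_diff[of y "insert y' Y" y' U]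
      by (metis insertCI linorder_neqE_nat)
  qed
qed

lemma commute_sym: "commute X Y \<longleftrightarrow> commute Y X"
  by (simp add: commute_def Int_commute)

lemma orders_imp_comm_step:
  assumes "\<rho> \<in> orders n k U" "\<sigma> \<in> orders n k U"
  shows "(\<rho>, \<sigma>) \<in> comm_step\<^sup>*"
  using ordersD[OF assms(1)] ordersD[OF assms(2)] commute_or_forced_before commute_sym
  by (intro sorted_wrt_imp_comm_step[of "\<lambda>Y Y'. \<not> forced_before U Y' Y"]) blast+

section \<open>Packets in lexicographic order\<close>

lemma sorted_list_of_set_diff_less:
  assumes "finite X" "x \<in> X" "y \<in> X" "x < (y::nat)"
  shows "sorted_list_of_set (X - {y}) < sorted_list_of_set (X - {x})"
proof -
  let ?L = "sorted_list_of_set X"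
  have L: "sorted_wrt (<) ?L" "set ?L = X" "distinct ?L" using assms(1) by auto
  obtain p q where pq: "?L = p @ x # q" using L(2) assms(2) by (metis split_list)
  have "y \<in> set q" using L(1,2) assms(3,4) unfolding pq by (fastforce simp: sorted_wrt_append)
  then obtain r s where rs: "q = r @ y # s" by (meson split_list)
  have d: "x \<notin> set p" "x \<notin> set q" "y \<notin> set p" "y \<notin> set r" "x \<noteq> y" using L(3) unfolding pq rs by auto
  have "sorted_list_of_set (X - {y}) = p @ x # r @ s"
    using assms(1) d by (simp add: sorted_list_of_set_remove pq rs remove1_append)
  moreover have "sorted_list_of_set (X - {x}) = p @ q"
    using assms(1) d by (simp add: sorted_list_of_set_remove pq remove1_append)
  \<comment> \<open>\<open>q\<close> contains \<open>y\<close>, so it has a first entry; after the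
    common prefix \<open>p\<close> the sequences have \<open>x\<close> and \<open>z\<close>.\<close>
  moreover obtain z t where q: "q = z # t" using rs by (cases r) auto
  moreover have "x < z" using L(1) unfolding pq q by (simp add: sorted_wrt_append)
  ultimately show ?thesis by (auto simp: list_less_def lexord_append_leftI)
qed

lemma lex_seq_properties:
  assumes "finite A" "\<And>Y. Y \<in> A \<Longrightarrow> finite Y"
  shows "distinct (lex_seq A)" "set (lex_seq A) = A"
    "sorted_wrt (\<lambda>Y Y'. sorted_list_of_set Y < sorted_list_of_set Y') (lex_seq A)"
proof -
  let ?S = "sorted_list_of_set (sorted_list_of_set ` A)"
  have S: "set ?S = sorted_list_of_set ` A" using assms(1) by simp
  have inv: "sorted_list_of_set (set L) = L" if "L \<in> set ?S" for L
    using that assms(2) unfolding S by auto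
  then have "inj_on set (set ?S)" by (metis inj_onI)
  then show "distinct (lex_seq A)" unfolding lex_seq_def by (simp add: distinct_map del: set_sorted_list_of_set)
  show "set (lex_seq A) = A"
    unfolding lex_seq_def set_map S image_image using assms(2) by simp
  show "sorted_wrt (\<lambda>Y Y'. sorted_list_of_set Y < sorted_list_of_set Y') (lex_seq A)"
    unfolding lex_seq_def sorted_wrt_map
    by (rule sorted_wrt_mono_rel[OF _ strict_sorted_list_of_set]) (simp add: inv del: set_sorted_list_of_set)
qed

text \<open>Antisymmetry replaces transitivity here, which suits the negated
  \<open>forced_before\<close>: different heads would each precede the other.\<close>

lemma sorted_wrt_unique:
  assumes "sorted_wrt R xs" "sorted_wrt R ys" "distinct xs" "distinct ys" "set xs = set ys"
    and "\<And>x y. x \<in> set xs \<Longrightarrow> y \<in> set xs \<Longrightarrow> x \<noteq> y \<Longrightarrow> \<not> (R x y \<and> R y x)"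
  shows "xs = ys"
  using assms
proof (induction xs arbitrary: ys)
  case (Cons x xs)
  then obtain y ys' where ys: "ys = y # ys'" by (cases ys) auto
  have "x = y"
  proof (rule ccontr)
    assume "x \<noteq> y"
    with Cons.prems(5) have "x \<in> set ys'" "y \<in> set xs" unfolding ys by auto
    with Cons.prems(1,2,6) \<open>x \<noteq> y\<close> show False unfolding ys by auto
  qed
  moreover have "xs = ys'"
  proof (rule Cons.IH)
    show "set xs = set ys'" using Cons.prems(3-5) \<open>x = y\<close> unfolding ys by auto
    show "\<not> (R x' y' \<and> R y' x')" if "x' \<in> set xs" "y' \<in> set xs" "x' \<noteq> y'" for x' y'
      using that by (intro Cons.prems(6)) auto
  qed (use Cons.prems(1-4) in \<open>auto simp: ys\<close>)
  ultimately show ?case by (simp add: ys)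
qed simp

lemma lex_seq_packet:
  assumes "finite X"
  shows "lex_seq (packet X) = lex_packet X"
proof (rule sorted_wrt_unique)
  have fin: "finite (packet X)" "\<And>Y. Y \<in> packet X \<Longrightarrow> finite Y"
    using assms by (auto simp: packet_def)
  note ls = lex_seq_properties[OF fin]
  show "distinct (lex_seq (packet X))"
    "sorted_wrt (\<lambda>Y Y'. sorted_list_of_set Y < sorted_list_of_set Y') (lex_seq (packet X))"
    using ls by blast+
  show "set (lex_seq (packet X)) = set (lex_packet X)"
    using ls(2) set_lex_packet[OF assms] by simp
  show "sorted_wrt (\<lambda>Y Y'. sorted_list_of_set Y < sorted_list_of_set Y') (lex_packet X)"
    unfolding lex_packet_def sorted_wrt_map sorted_wrt_rev
    by (rule sorted_wrt_mono_rel[OF _ strict_sorted_list_of_set])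
      (use assms in \<open>auto intro: sorted_list_of_set_diff_less\<close>)
qed (auto simp: distinct_lex_packet)

text \<open>Any two distinct members of a packet are compared by \<open>forced_before\<close>, so
  only one enumeration of it is compatible with \<open>U\<close>.\<close>

lemma seq_restrict_orders:
  assumes \<rho>: "\<rho> \<in> orders n k U" and X: "X \<in> nsets {1..n} (Suc k)"
  shows "seq_restrict \<rho> (packet X) = (if X \<in> U then rev (lex_packet X) else lex_packet X)"
proof (rule sorted_wrt_unique)
  note \<rho>d = ordersD[OF \<rho>]
  have "finite X" using X by (rule nsetsD)
  have sub: "packet X \<subseteq> set \<rho>" using packet_subset_nsets[of X n k] X \<rho>d(2) by simp
  show "sorted_wrt (\<lambda>Y Y'. \<not> forced_before U Y' Y) (seq_restrict \<rho> (packet X))"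
    using \<rho>d(3) unfolding seq_restrict_def by (rule sorted_wrt_filter)
  show "sorted_wrt (\<lambda>Y Y'. \<not> forced_before U Y' Y) (if X \<in> U then rev (lex_packet X) else lex_packet X)"
    using \<open>finite X\<close> by (simp add: sorted_wrt_lex_packet sorted_wrt_rev_lex_packet)
  show "distinct (seq_restrict \<rho> (packet X))"
    using \<rho>d(1) by (simp add: seq_restrict_def)
  show "distinct (if X \<in> U then rev (lex_packet X) else lex_packet X)"
    by (simp add: distinct_lex_packet)
  show "set (seq_restrict \<rho> (packet X)) = set (if X \<in> U then rev (lex_packet X) else lex_packet X)"
    using sub \<open>finite X\<close> by (auto simp: seq_restrict_def set_lex_packet)
  show "\<not> (\<not> forced_before U Y' Y \<and> \<not> forced_before U Y Y')"
    if "Y \<in> set (seq_restrict \<rho> (packet X))" "Y' \<in> set (seq_restrict \<rho> (packet X))" "Y \<noteq> Y'" for Y Y'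
  proof -
    from that obtain x y where "Y = X - {x}" "Y' = X - {y}" "x \<in> X" "y \<in> X"
      by (auto simp: seq_restrict_def packet_def)
    with \<open>Y \<noteq> Y'\<close> show ?thesis using forced_before_packet_iff[of x X y U] forced_before_packet_iff[of y X x U]
      by (auto split: if_splits)
  qed
qed

section \<open>Inversion sets of admissible orders\<close>

definition inversions :: "nat \<Rightarrow> nat \<Rightarrow> nat set list \<Rightarrow> nat set set" where
  "inversions n k \<rho> = {X \<in> nsets {1..n} (Suc k). seq_restrict \<rho> (packet X) = rev (lex_packet X)}"

lemma admissible_iff:
  "\<rho> \<in> admissible n k \<longleftrightarrow> \<rho> \<in> permutations_of_set (nsets {1..n} k) \<and>
     (\<forall>X \<in> nsets {1..n} (Suc k). seq_restrict \<rho> (packet X) \<in> {lex_packet X, rev (lex_packet X)})"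
  unfolding admissible_def using lex_seq_packet by (auto simp: nsets_def)

lemma orders_subset_admissible: "orders n k U \<subseteq> admissible n k"
  by (auto simp: admissible_iff seq_restrict_orders) (simp add: orders_def)

text \<open>A palindromic list would be sorted both for \<open>{}\<close> and for
  \<open>{X}\<close>, which force opposite orders on its first two entries.\<close>

lemma lex_packet_neq_rev:
  assumes "card X \<ge> 2"
  shows "lex_packet X \<noteq> rev (lex_packet X)"
proof
  assume *: "lex_packet X = rev (lex_packet X)"
  have "finite X" using assms by (metis card.infinite not_numeral_le_zero)
  have "sorted_wrt (\<lambda>Y Y'. \<not> forced_before {} Y' Y) (lex_packet X)"
    "sorted_wrt (\<lambda>Y Y'. \<not> forced_before {X} Y' Y) (lex_packet X)"
    using sorted_wrt_lex_packet[of X "{}"] sorted_wrt_rev_lex_packet[of X "{X}"] \<open>finite X\<close> *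
    by auto
  moreover obtain Y Y' L where L: "lex_packet X = Y # Y' # L"
  proof -
    have "length (lex_packet X) = card X" by (simp add: lex_packet_def)
    with assms show ?thesis using that by (cases "lex_packet X"; cases "tl (lex_packet X)") auto
  qed
  ultimately have f: "\<not> forced_before {} Y' Y" "\<not> forced_before {X} Y' Y" by auto
  have "Y \<in> packet X" "Y' \<in> packet X" using set_lex_packet[OF \<open>finite X\<close>] unfolding L by auto
  then obtain x y where "Y = X - {x}" "Y' = X - {y}" "x \<in> X" "y \<in> X" by (auto simp: packet_def)
  moreover have "Y \<noteq> Y'" using distinct_lex_packet[of X] unfolding L by simp
  ultimately show False using f forced_before_packet_iff[of y X x] by (metis insertI1 empty_iff linorder_neqE_nat)
qed

text \<open>For \<open>k > 0\<close> packets have at least two members, so an inverted packet is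
  distinguishable from one in lexicographic order.\<close>

lemma inversions_orders:
  assumes "\<rho> \<in> orders n k U" "k > 0" "U \<subseteq> nsets {1..n} (Suc k)"
  shows "inversions n k \<rho> = U"
  using assms lex_packet_neq_rev unfolding inversions_def
  by (auto simp: seq_restrict_orders nsets_def split: if_splits)

text \<open>A violated comparison would show in the restriction to the packet of its witness, which
  by admissibility is sorted one way or the other.\<close>

lemma orders_inversions:
  assumes "\<rho> \<in> admissible n k"
  shows "\<rho> \<in> orders n k (inversions n k \<rho>)"
proof (rule ordersI)
  let ?U = "inversions n k \<rho>"
  show "distinct \<rho>" "set \<rho> = nsets {1..n} k"
    using assms by (auto simp: admissible_iff permutations_of_set_def)
  show "sorted_wrt (\<lambda>Y Y'. \<not> forced_before ?U Y' Y) \<rho>"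
    unfolding sorted_wrt_iff_split
  proof (intro allI impI notI)
    fix u Y v Y' w assume \<rho>: "\<rho> = u @ Y # v @ Y' # w" and f: "forced_before ?U Y' Y"
    then obtain X x y where X: "x \<in> X" "y \<in> X" "Y' = X - {x}" "Y = X - {y}"
      "X \<in> ?U \<and> x < y \<or> X \<notin> ?U \<and> y < x" by (metis forced_beforeE)
    have Y: "Y \<in> nsets {1..n} k" "Y' \<in> nsets {1..n} k"
      unfolding \<open>set \<rho> = _\<close>[symmetric] \<rho> by auto
    have "x \<noteq> y" using X(5) by blast
    then have "X = insert y Y" "y \<notin> Y" "y \<in> Y'" using X by auto
    then have Xk: "X \<in> nsets {1..n} (Suc k)" using Y by (auto simp: nsets_def)
    then have "finite X" by (rule nsetsD)
    let ?r = "\<lambda>u. seq_restrict u (packet X)"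
    have "Y \<in> packet X" "Y' \<in> packet X" using X by (auto simp: packet_def)
    then have r: "?r \<rho> = ?r u @ Y # ?r v @ Y' # ?r w" unfolding \<rho> by (simp add: seq_restrict_def)
    have "sorted_wrt (\<lambda>Y Y'. \<not> forced_before ?U Y' Y) (?r \<rho>)"
    proof (cases "X \<in> ?U")
      case True
      then have "?r \<rho> = rev (lex_packet X)" by (simp add: inversions_def)
      then show ?thesis using sorted_wrt_rev_lex_packet[OF \<open>finite X\<close> True] by simp
    next
      case False
      then have "?r \<rho> = lex_packet X" using assms Xk by (auto simp: inversions_def admissible_iff)
      then show ?thesis using sorted_wrt_lex_packet[OF \<open>finite X\<close> False] by simp
    qed
    then show False using f unfolding r by (simp add: sorted_wrt_append)
  qed
qed

text \<open>Distinct members \<open>X - {y}\<close> and \<open>X - {z}\<close> of a packet share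
  \<open>X - {y} - {z}\<close>, so they never commute.\<close>

lemma seq_restrict_packet_comm_step:
  assumes "(\<rho>, \<sigma>) \<in> comm_step"
  shows "seq_restrict \<rho> (packet X) = seq_restrict \<sigma> (packet X)"
proof -
  from assms obtain u v Y Z where uv: "\<rho> = u @ [Y, Z] @ v" "\<sigma> = u @ [Z, Y] @ v" and YZ: "commute Y Z"
    unfolding comm_step_def by blast
  have "Y = Z" if "Y \<in> packet X" "Z \<in> packet X"
  proof (rule ccontr)
    assume "Y \<noteq> Z"
    from that obtain y z where "y \<in> X" "z \<in> X" "Y = X - {y}" "Z = X - {z}" by (auto simp: packet_def)
    moreover from this \<open>Y \<noteq> Z\<close> have "y \<noteq> z" by auto
    ultimately have "X - {y} - {z} \<in> packet Y" "X - {z} - {y} \<in> packet Z" by (auto simp: packet_def)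
    moreover have "X - {y} - {z} = X - {z} - {y}" by auto
    ultimately show False using YZ unfolding commute_def by (metis disjoint_iff)
  qed
  then show ?thesis by (auto simp: uv seq_restrict_def)
qed

lemma inversions_comm_equiv:
  assumes "(\<rho>, \<sigma>) \<in> comm_equiv n k"
  shows "inversions n k \<rho> = inversions n k \<sigma>"
proof -
  have "seq_restrict \<rho> (packet X) = seq_restrict \<sigma> (packet X)" for X
  proof -
    from assms have "(\<rho>, \<sigma>) \<in> comm_step\<^sup>*" by (simp add: comm_equiv_def)
    then show ?thesis by induction (auto dest: seq_restrict_packet_comm_step)
  qed
  then show ?thesis by (simp add: inversions_def)
qed

text \<open>Commutations preserve inversions, and orders with the same inversions are connected by
  commutations.\<close>

lemma comm_class_eq_orders:
  assumes "\<rho> \<in> orders n k U" "k > 0" "U \<subseteq> nsets {1..n} (Suc k)"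
  shows "comm_class n k \<rho> = orders n k U"
proof (intro equalityI subsetI)
  fix \<sigma> assume "\<sigma> \<in> comm_class n k \<rho>"
  then have "(\<rho>, \<sigma>) \<in> comm_equiv n k" by (simp add: comm_class_def)
  then have "inversions n k \<sigma> = U" "\<sigma> \<in> admissible n k"
    using inversions_comm_equiv inversions_orders[OF assms] by (auto simp: comm_equiv_def)
  then show "\<sigma> \<in> orders n k U" using orders_inversions by blast
next
  fix \<sigma> assume "\<sigma> \<in> orders n k U"
  then show "\<sigma> \<in> comm_class n k \<rho>"
    using assms(1) orders_subset_admissible orders_imp_comm_step
    by (auto simp: comm_class_def comm_equiv_def)
qed

lemma lex_seq_mem_orders: "lex_seq (nsets {1..n} k) \<in> orders n k {}"
proof (rule ordersI)
  have fin: "finite (nsets {1..n} k)" "\<And>Y. Y \<in> nsets {1..n} k \<Longrightarrow> finite Y"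
    by (auto simp: finite_imp_finite_nsets nsetsD)
  note ls = lex_seq_properties[OF fin]
  show "distinct (lex_seq (nsets {1..n} k))" "set (lex_seq (nsets {1..n} k)) = nsets {1..n} k"
    using ls by blast+
  show "sorted_wrt (\<lambda>Y Y'. \<not> forced_before {} Y' Y) (lex_seq (nsets {1..n} k))"
  proof (rule sorted_wrt_mono_rel[OF _ ls(3)], rule notI)
    fix Y Y' assume "Y \<in> set (lex_seq (nsets {1..n} k))" "Y' \<in> set (lex_seq (nsets {1..n} k))"
      and Y: "sorted_list_of_set Y < sorted_list_of_set Y'" "forced_before {} Y' Y"
    then have "finite Y'" using ls(2) nsetsD(2) by blast
    from Y(2) obtain X x y where X: "x \<in> X" "y \<in> X" "Y' = X - {x}" "Y = X - {y}" "y < x"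
      by (auto elim!: forced_beforeE)
    have "finite X" using X(3) \<open>finite Y'\<close> by simp
    then show False using sorted_list_of_set_diff_less[of X y x] X Y(1) by simp
  qed
qed

section \<open>The fibre over the lexicographic order\<close>

text \<open>A forced comparison strictly increases the position in \<open>\<rho>\<close>.\<close>

lemma forced_before_cycle:
  assumes \<rho>: "\<rho> \<in> orders n k U" and "a \<in> set \<rho>" "b \<in> set \<rho>" "c \<in> set \<rho>"
    and "forced_before U a b" "forced_before U b c" "forced_before U c a"
  shows False
proof -
  from assms(2-4) obtain i j l where i: "i < length \<rho>" "\<rho> ! i = a" and j: "j < length \<rho>" "\<rho> ! j = b"
    and l: "l < length \<rho>" "\<rho> ! l = c" by (metis in_set_conv_nth)
  have less: "p < q" if "p < length \<rho>" "forced_before U (\<rho> ! p) (\<rho> ! q)" for p q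
  proof (rule ccontr)
    assume "\<not> p < q"
    then consider "q < p" | "p = q" by linarith
    then show False
      using that ordersD(3)[OF \<rho>] forced_before_irrefl unfolding sorted_wrt_iff_nth_less by cases auto
  qed
  have "i < j" "j < l" "l < i" using less assms(5-7) i j l by auto
  then show False by simp
qed

text \<open>The last condition expresses that the deletion is lexicographic: a member avoiding
  \<open>n\<close> would be an inversion of it.\<close>

definition upsets :: "nat \<Rightarrow> nat \<Rightarrow> nat set set set" where
  "upsets n k = {U. U \<subseteq> nsets {1..n} (Suc k) \<and> up_closed n U \<and> (\<forall>X \<in> U. n \<in> X)}"

lemma inversions_deletion:
  "inversions (n - 1) k (deletion n k \<rho>) = inversions n k \<rho> \<inter> nsets {1..n - 1} (Suc k)"
proof -
  have "nsets {1..n - 1} (Suc k) \<subseteq> nsets {1..n} (Suc k)" by (rule nsets_mono) auto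
  moreover have "seq_restrict (deletion n k \<rho>) (packet X) = seq_restrict \<rho> (packet X)"
    if "X \<in> nsets {1..n - 1} (Suc k)" for X
    unfolding deletion_def seq_restrict_def filter_filter
    by (rule filter_cong) (use packet_subset_nsets[of X "n - 1" k] that in auto)
  ultimately show ?thesis unfolding inversions_def by auto
qed

lemma comm_class_lex_seq:
  assumes "k > 0"
  shows "comm_class n k (lex_seq (nsets {1..n} k)) = orders n k {}"
  using comm_class_eq_orders[OF lex_seq_mem_orders assms] by simp

lemma deletion_class_orders:
  assumes "\<rho> \<in> orders n k U" "k > 0" "U \<subseteq> nsets {1..n} (Suc k)"
  shows "deletion_class n k (orders n k U) = orders (n - 1) k (U \<inter> nsets {1..n - 1} (Suc k))"
proof -
  have \<rho>: "\<rho> \<in> admissible n k" using assms(1) orders_subset_admissible by blast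
  have "inversions (n - 1) k (deletion n k \<rho>) = U \<inter> nsets {1..n - 1} (Suc k)"
    unfolding inversions_deletion inversions_orders[OF assms] ..
  then have "deletion n k \<rho> \<in> orders (n - 1) k (U \<inter> nsets {1..n - 1} (Suc k))"
    using orders_inversions[OF deletion_admissible[OF \<rho>]] by simp
  then have "comm_class (n - 1) k (deletion n k \<rho>) = orders (n - 1) k (U \<inter> nsets {1..n - 1} (Suc k))"
    using assms(2) by (intro comm_class_eq_orders) auto
  then show ?thesis
    using deletion_class_comm_class[OF \<rho>] comm_class_eq_orders[OF assms] by simp
qed

lemma orders_eq_imp_eq:
  assumes "\<rho> \<in> orders n k U" "orders n k U = orders n k V" "k > 0"
    "U \<subseteq> nsets {1..n} (Suc k)" "V \<subseteq> nsets {1..n} (Suc k)"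
  shows "U = V"
  using assms inversions_orders by metis

text \<open>Let \<open>Z = X \<union> {y}\<close> with \<open>X \<in> U\<close>. Since \<open>Z - {n} \<notin> U\<close>, the assumption
  \<open>Z - {x} \<notin> U\<close> would order \<open>Z - {x, y}\<close>, \<open>Z - {y, n}\<close>, \<open>Z - {x, n}\<close> cyclically.\<close>

lemma up_closed_inversions:
  assumes \<rho>: "\<rho> \<in> orders n k U" and U: "U \<subseteq> nsets {1..n} (Suc k)" "\<forall>X \<in> U. n \<in> X"
  shows "up_closed n U"
  unfolding up_closed_def
proof (intro ballI impI)
  fix X x y assume X: "X \<in> U" "x \<in> X" "y \<in> {1..n} - X" "x < y"
  show "insert y (X - {x}) \<in> U"
  proof (rule ccontr)
    assume not: "insert y (X - {x}) \<notin> U"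
    have "n \<in> X" and Xk: "X \<subseteq> {1..n}" "finite X" "card X = Suc k" using U X(1) by (auto simp: nsets_def)
    have "y < n" using X(3) \<open>n \<in> X\<close> by (cases "y = n") auto
    let ?Z = "insert y X"
    have eqs: "?Z - {y} = X" "?Z - {x} = insert y (X - {x})" using X by auto
    have "n \<notin> ?Z - {n}" by simp
    then have n: "?Z - {n} \<notin> U" using U(2) by blast
    have sub: "?Z - {p} - {q} \<in> set \<rho>" if "p \<in> ?Z" "q \<in> ?Z" "p \<noteq> q" for p q
      using that Xk X(3) unfolding ordersD(2)[OF \<rho>] by (auto simp: nsets_def card_Diff_singleton_if)
    have comm: "?Z - {p} - {q} = ?Z - {q} - {p}" for p q by auto
    \<comment> \<open>The three comparisons come from \<open>?Z - {y} \<in> U\<close> with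
      \<open>x < n\<close>, \<open>?Z - {n} \<notin> U\<close> with \<open>x < y\<close>, and
      \<open>?Z - {x} \<notin> U\<close> with \<open>y < n\<close>.\<close>
    have a: "forced_before U (?Z - {y} - {x}) (?Z - {y} - {n})"
      using X \<open>n \<in> X\<close> \<open>y < n\<close> unfolding eqs(1) by (intro forced_before_diff) auto
    have b: "forced_before U (?Z - {n} - {y}) (?Z - {n} - {x})"
      using X \<open>n \<in> X\<close> \<open>y < n\<close> n by (intro forced_before_diff) auto
    have "?Z - {x} \<notin> U" using not eqs(2) by simp
    then have c: "forced_before U (?Z - {x} - {n}) (?Z - {x} - {y})"
      using X \<open>n \<in> X\<close> \<open>y < n\<close> by (intro forced_before_diff) auto
    show False
    proof (rule forced_before_cycle[OF \<rho> _ _ _ a])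
      show "?Z - {y} - {x} \<in> set \<rho>" "?Z - {y} - {n} \<in> set \<rho>" "?Z - {x} - {n} \<in> set \<rho>"
        using X \<open>n \<in> X\<close> \<open>y < n\<close> by (intro sub; simp)+
      show "forced_before U (?Z - {y} - {n}) (?Z - {x} - {n})" using b by (simp only: comm[of _ n])
      show "forced_before U (?Z - {x} - {n}) (?Z - {y} - {x})" using c by (simp only: comm[of y x])
    qed
  qed
qed

lemma higher_bruhat_fibre:
  assumes "k > 0" "n > 0"
  shows "{C \<in> higher_bruhat n k.
      deletion_class n k C = comm_class (n - 1) k (lex_seq (nsets {1..n - 1} k))} =
    orders n k ` upsets n k"
proof (intro equalityI subsetI)
  fix C assume "C \<in> {C \<in> higher_bruhat n k.
      deletion_class n k C = comm_class (n - 1) k (lex_seq (nsets {1..n - 1} k))}"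
  then have "C \<in> higher_bruhat n k" and del: "deletion_class n k C = orders (n - 1) k {}"
    unfolding comm_class_lex_seq[OF assms(1)] by blast+
  then obtain \<rho> where \<rho>: "\<rho> \<in> admissible n k" "C = comm_class n k \<rho>"
    unfolding higher_bruhat_def comm_class_def by (blast elim: quotientE)
  define U where "U = inversions n k \<rho>"
  have U: "\<rho> \<in> orders n k U" "U \<subseteq> nsets {1..n} (Suc k)"
    using orders_inversions[OF \<rho>(1)] by (auto simp: U_def inversions_def)
  have C: "C = orders n k U" using comm_class_eq_orders U assms(1) \<rho>(2) by blast
  have "orders (n - 1) k {} = orders (n - 1) k (U \<inter> nsets {1..n - 1} (Suc k))"
    using del deletion_class_orders[OF U(1) assms(1) U(2)] C by simp
  then have e: "U \<inter> nsets {1..n - 1} (Suc k) = {}"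
    using orders_eq_imp_eq[OF lex_seq_mem_orders _ assms(1)] by blast
  have "n \<in> X" if "X \<in> U" for X
  proof (rule ccontr)
    assume "n \<notin> X"
    from that U have X: "X \<in> nsets {1..n} (Suc k)" by blast
    have "X \<subseteq> {1..n - 1}"
    proof
      fix x assume "x \<in> X"
      with X \<open>n \<notin> X\<close> have "x \<in> {1..n}" "x \<noteq> n" by (auto simp: nsets_def)
      then show "x \<in> {1..n - 1}" by auto
    qed
    with X that e show False by (auto simp: nsets_def)
  qed
  then have "U \<in> upsets n k" using U up_closed_inversions by (simp add: upsets_def)
  then show "C \<in> orders n k ` upsets n k" using C by blast
next
  fix C assume "C \<in> orders n k ` upsets n k"
  then obtain U where C: "C = orders n k U" and U: "U \<subseteq> nsets {1..n} (Suc k)" "up_closed n U" "\<forall>X \<in> U. n \<in> X"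
    by (auto simp: upsets_def)
  obtain \<rho> where \<rho>: "\<rho> \<in> orders n k U" using orders_nonempty[OF U(2)] by blast
  then have "\<rho> \<in> admissible n k" using orders_subset_admissible by blast
  then have "C \<in> higher_bruhat n k"
    unfolding C comm_class_eq_orders[OF \<rho> assms(1) U(1), symmetric] comm_class_def higher_bruhat_def
    by (rule quotientI)
  moreover have "U \<inter> nsets {1..n - 1} (Suc k) = {}"
    using U(3) assms(2) by (fastforce simp: nsets_def)
  ultimately show "C \<in> {C \<in> higher_bruhat n k.
      deletion_class n k C = comm_class (n - 1) k (lex_seq (nsets {1..n - 1} k))}"
    unfolding comm_class_lex_seq[OF assms(1)]
    using deletion_class_orders[OF \<rho> assms(1) U(1)] by (simp add: C)
qed

section \<open>The order on the fibre\<close>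

lemma hb_step_orders:
  assumes "(orders n k U, D) \<in> hb_step n k" "k > 0" "U \<subseteq> nsets {1..n} (Suc k)"
  shows "\<exists>V. D = orders n k V \<and> V \<subseteq> nsets {1..n} (Suc k) \<and> U \<subseteq> V"
proof -
  from assms(1) obtain \<rho> \<sigma> X u v where D: "D \<in> higher_bruhat n k" "\<sigma> \<in> D"
    and \<rho>: "\<rho> \<in> orders n k U" and X: "X \<in> nsets {1..n} (Suc k)"
    and uv: "\<rho> = u @ lex_seq (packet X) @ v" "\<sigma> = u @ rev (lex_seq (packet X)) @ v"
    unfolding hb_step_def by auto
  have X': "finite X" "card X = Suc k" using X by (auto dest: nsetsD)
  note uv' = uv[unfolded lex_seq_packet[OF X'(1)]]
  have "set u \<inter> packet X = {}" "set v \<inter> packet X = {}"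
    using ordersD(1)[OF \<rho>] set_lex_packet[OF X'(1)] unfolding uv' by auto
  then have "seq_restrict \<rho> (packet X) = lex_packet X"
    unfolding uv' seq_restrict_def using set_lex_packet[OF X'(1)]
    by (auto simp: filter_empty_conv disjoint_iff)
  \<comment> \<open>A member of \<open>U\<close> would have its packet reversed. Hence the step
    turns \<open>U\<close> into \<open>insert X U\<close>.\<close>
  then have "X \<notin> U"
    using seq_restrict_orders[OF \<rho> X] lex_packet_neq_rev[of X] X' assms(2) by auto
  then have \<sigma>: "\<sigma> \<in> orders n k (insert X U)"
    using orders_reverse_packet \<rho> X'(1) unfolding uv' by blast
  have "D = comm_class n k \<sigma>"
    using D equiv_comm_equiv[of n k] unfolding higher_bruhat_def comm_class_def
    by (metis Image_singleton_iff equiv_class_eq quotientE)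
  also have "\<dots> = orders n k (insert X U)"
    using \<sigma> assms X by (intro comm_class_eq_orders) auto
  finally show ?thesis using assms(3) X by blast
qed

text \<open>Intermediate classes of a chain are not assumed to lie in the fibre, so the invariant
  only asks for an inversion set containing \<open>U\<close>.\<close>

lemma hb_le_imp_subset:
  assumes "hb_le n k (orders n k U) (orders n k V)" "k > 0" "U \<in> upsets n k" "V \<in> upsets n k"
  shows "U \<subseteq> V"
proof -
  have "\<exists>W. D = orders n k W \<and> W \<subseteq> nsets {1..n} (Suc k) \<and> U \<subseteq> W"
    if "(orders n k U, D) \<in> (hb_step n k)\<^sup>*" for D
    using that
  proof induction
    case base
    then show ?case using assms(3) by (auto simp: upsets_def)
  next
    case (step D E)
    then show ?case using hb_step_orders[OF _ assms(2)] by (metis order_trans)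
  qed
  then obtain W where W: "orders n k V = orders n k W" "W \<subseteq> nsets {1..n} (Suc k)" "U \<subseteq> W"
    using assms(1) unfolding hb_le_def by blast
  obtain \<rho> where "\<rho> \<in> orders n k V" using orders_nonempty[of n V k] assms(4) by (auto simp: upsets_def)
  then have "V = W" using W assms(2,4) by (intro orders_eq_imp_eq) (auto simp: upsets_def)
  with W show ?thesis by simp
qed

text \<open>Up-closure of \<open>insert X U\<close> makes \<open>X\<close> addable, so its packet
  can be made consecutive and reversed.\<close>

lemma hb_step_insert:
  assumes "k > 0" "U \<in> upsets n k" "insert X U \<in> upsets n k" "X \<notin> U"
  shows "(orders n k U, orders n k (insert X U)) \<in> hb_step n k"
proof -
  have U: "U \<subseteq> nsets {1..n} (Suc k)" "up_closed n U" and XU: "insert X U \<subseteq> nsets {1..n} (Suc k)"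
    "up_closed n (insert X U)"
    using assms(2,3) by (auto simp: upsets_def)
  have X: "X \<in> nsets {1..n} (Suc k)" "X \<subseteq> {1..n}" "finite X" using XU by (auto dest: nsetsD)
  have "insert y (X - {x}) \<in> U" if "x \<in> X" "y \<in> {1..n} - X" "x < y" for x y
  proof -
    have "insert y (X - {x}) \<in> insert X U"
      using that X by (intro up_closedD[OF XU(2)]) auto
    moreover have "insert y (X - {x}) \<noteq> X" using that by blast
    ultimately show ?thesis by blast
  qed
  then have "addable n U X" using assms(4) by (simp add: addable_def)
  then obtain u v where uv: "u @ lex_packet X @ v \<in> orders n k U"
    using ex_order_with_lex_packet U(2) X(1) by blast
  then have uv': "u @ rev (lex_packet X) @ v \<in> orders n k (insert X U)"
    using X(3) assms(4) by (rule orders_reverse_packet)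
  have mem: "orders n k W \<in> higher_bruhat n k" if "\<rho> \<in> orders n k W" "W \<subseteq> nsets {1..n} (Suc k)" for \<rho> W
    using that orders_subset_admissible comm_class_eq_orders[OF that(1) assms(1) that(2)]
    unfolding comm_class_def higher_bruhat_def by (metis quotientI subsetD)
  show ?thesis
    unfolding hb_step_def mem_Collect_eq case_prod_conv
  proof (intro conjI bexI exI)
    show "u @ lex_packet X @ v = u @ lex_seq (packet X) @ v"
      "u @ rev (lex_packet X) @ v = u @ rev (lex_seq (packet X)) @ v"
      by (simp_all add: lex_seq_packet[OF X(3)])
  qed (use uv uv' X(1) mem[OF uv U(1)] mem[OF uv' XU(1)] in auto)
qed

text \<open>A set of maximal sum in \<open>V - U\<close> can be added to \<open>U\<close>.\<close>

lemma subset_imp_hb_le: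
  assumes "k > 0" "U \<in> upsets n k" "V \<in> upsets n k" "U \<subseteq> V"
  shows "hb_le n k (orders n k U) (orders n k V)"
  using assms(2,4)
proof (induction "card (V - U)" arbitrary: U)
  case 0
  have "V \<subseteq> nsets {1..n} (Suc k)" using assms(3) by (simp add: upsets_def)
  then have "finite V" by (rule finite_subset) (simp add: finite_imp_finite_nsets)
  with 0 have "U = V" by auto
  then show ?case by (simp add: hb_le_def)
next
  case (Suc d)
  have fin: "finite (V - U)" using Suc.hyps(2) by (metis card.infinite nat.distinct(1))
  have ne: "V - U \<noteq> {}" using Suc.hyps(2) by (metis card.empty nat.distinct(1))
  have "Max (\<Sum> ` (V - U)) \<in> \<Sum> ` (V - U)" using fin ne by simp
  then obtain X where X: "X \<in> V" "X \<notin> U" and "\<Sum>X = Max (\<Sum> ` (V - U))" by auto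
  then have max: "\<Sum>Y \<le> \<Sum>X" if "Y \<in> V - U" for Y
    using that fin by simp
  have V: "V \<subseteq> nsets {1..n} (Suc k)" "up_closed n V" using assms(3) by (auto simp: upsets_def)
  have X': "X \<subseteq> {1..n}" "finite X" using X V(1) by (auto dest: nsetsD)
  \<comment> \<open>The exchange stays in \<open>V\<close> and raises the sum, so maximality leaves
    only \<open>U\<close>.\<close>
  have add: "insert y (X - {x}) \<in> U" if "x \<in> X" "y \<in> {1..n} - X" "x < y" for x y
  proof (rule ccontr)
    assume "insert y (X - {x}) \<notin> U"
    moreover have "insert y (X - {x}) \<in> V"
      using that X X' by (intro up_closedD[OF V(2)]) auto
    ultimately have "\<Sum>(insert y (X - {x})) \<le> \<Sum>X" using max by blast
    moreover have "\<Sum>(insert y (X - {x})) = y + \<Sum>(X - {x})" using that X' by simp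
    moreover have "\<Sum>X = x + \<Sum>(X - {x})" using that X' by (simp add: sum.remove)
    ultimately show False using that(3) by simp
  qed
  have ins: "insert X U \<in> upsets n k"
  proof -
    have "up_closed n U" using Suc.prems(1) by (simp add: upsets_def)
    then have "up_closed n (insert X U)" using add unfolding up_closed_def by blast
    then show ?thesis using Suc.prems(1) assms(3) X(1) by (auto simp: upsets_def)
  qed
  have "V - insert X U = (V - U) - {X}" by auto
  then have "d = card (V - insert X U)" using Suc.hyps(2) X by (simp add: card_Diff_singleton_if)
  then have "hb_le n k (orders n k (insert X U)) (orders n k V)"
    using ins X(1) Suc.prems(2) by (intro Suc.hyps(1)) auto
  with hb_step_insert[OF assms(1) Suc.prems(1) ins X(2)] show ?case
    unfolding hb_le_def by (rule converse_rtrancl_into_rtrancl)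
qed

section \<open>Totally symmetric plane partitions\<close>

text \<open>The shifts by 0, 1, 2 make weakly increasing triples strictly increasing.\<close>

definition cotriple :: "nat \<Rightarrow> nat \<Rightarrow> nat \<Rightarrow> nat \<Rightarrow> nat set" where
  "cotriple n a b c = {1..n} - {a, b + 1, c + 2}"

text \<open>Sorted triples represent each orbit of the symmetric group once.\<close>

definition tspp_upset :: "nat \<Rightarrow> (nat \<times> nat \<times> nat) set \<Rightarrow> nat set set" where
  "tspp_upset n T = {cotriple n a b c | a b c. (a, b, c) \<in> T \<and> a \<le> b \<and> b \<le> c}"

lemma tspp_upsetI:
  "(a, b, c) \<in> T \<Longrightarrow> a \<le> b \<Longrightarrow> b \<le> c \<Longrightarrow> cotriple n a b c \<in> tspp_upset n T"
  unfolding tspp_upset_def by blast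

lemma tspp_box:
  assumes "T \<in> tspp m" "(a, b, c) \<in> T"
  shows "1 \<le> a" "a \<le> m" "1 \<le> b" "b \<le> m" "1 \<le> c" "c \<le> m"
proof -
  have "T \<subseteq> {1..m} \<times> {1..m} \<times> {1..m}" using assms(1) by (simp add: tspp_def)
  with assms(2) have "(a, b, c) \<in> {1..m} \<times> {1..m} \<times> {1..m}" by blast
  then show "1 \<le> a" "a \<le> m" "1 \<le> b" "b \<le> m" "1 \<le> c" "c \<le> m" by auto
qed

lemma tspp_down:
  assumes "T \<in> tspp m" "(a, b, c) \<in> T" "1 \<le> a'" "a' \<le> a" "1 \<le> b'" "b' \<le> b" "1 \<le> c'" "c' \<le> c"
  shows "(a', b', c') \<in> T"
proof -
  have "{1..a} \<times> {1..b} \<times> {1..c} \<subseteq> T" using assms(1,2) unfolding tspp_def by blast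
  moreover have "(a', b', c') \<in> {1..a} \<times> {1..b} \<times> {1..c}" using assms(3-) by simp
  ultimately show ?thesis by blast
qed

lemma tspp_perm:
  assumes "T \<in> tspp m"
  shows "(a, b, c) \<in> T \<longleftrightarrow> (b, a, c) \<in> T" "(a, b, c) \<in> T \<longleftrightarrow> (a, c, b) \<in> T"
proof -
  have *: "(a, c, b) \<in> T" "(b, a, c) \<in> T" if "(a, b, c) \<in> T" for a b c
    using assms that unfolding tspp_def by blast+
  show "(a, b, c) \<in> T \<longleftrightarrow> (b, a, c) \<in> T" "(a, b, c) \<in> T \<longleftrightarrow> (a, c, b) \<in> T"
    using * by blast+
qed

section \<open>Sets containing \<open>n\<close> as complements of triples\<close>

lemma cotriple_inj:
  assumes "cotriple n a b c = cotriple n a' b' c'"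
    and "1 \<le> a" "a \<le> b" "b \<le> c" "c + 2 \<le> n" "1 \<le> a'" "a' \<le> b'" "b' \<le> c'" "c' + 2 \<le> n"
  shows "a = a' \<and> b = b' \<and> c = c'"
proof -
  have "{a, b + 1, c + 2} = {1..n} - cotriple n a b c"
    using assms(2-5) unfolding cotriple_def by auto
  also have "\<dots> = {a', b' + 1, c' + 2}"
    unfolding assms(1) unfolding cotriple_def using assms(6-9) by auto
  finally have e: "{a, b + 1, c + 2} = {a', b' + 1, c' + 2}" .
  have "[a, b + 1, c + 2] = [a', b' + 1, c' + 2]"
  proof (rule strict_sorted_equal)
    show "set [a, b + 1, c + 2] = set [a', b' + 1, c' + 2]" unfolding list.set using e by blast
  qed (use assms(2-) in simp_all)
  then show ?thesis by simp
qed

lemma cotriple_mem_nsets: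
  assumes "1 \<le> a" "a \<le> b" "b \<le> c" "c + 3 \<le> n"
  shows "cotriple n a b c \<in> nsets {1..n} (n - 3)" "n \<in> cotriple n a b c"
proof -
  have "card {a, b + 1, c + 2} = 3" using assms by (simp add: card_insert_if)
  moreover have "{a, b + 1, c + 2} \<subseteq> {1..n}" using assms by auto
  ultimately have "card (cotriple n a b c) = n - 3"
    unfolding cotriple_def by (simp add: card_Diff_subset del: insert_subset)
  then show "cotriple n a b c \<in> nsets {1..n} (n - 3)"
    by (auto simp: nsets_def cotriple_def)
  show "n \<in> cotriple n a b c" using assms by (auto simp: cotriple_def)
qed

lemma ex_cotriple:
  assumes "X \<in> nsets {1..n} (n - 3)" "n \<in> X" "n \<ge> 3"
  obtains a b c where "X = cotriple n a b c" "1 \<le> a" "a \<le> b" "b \<le> c" "c + 3 \<le> n"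
proof -
  have X: "X \<subseteq> {1..n}" "finite X" "card X = n - 3" using assms(1) by (auto simp: nsets_def)
  have "card ({1..n} - X) = 3" using X assms(3) by (simp add: card_Diff_subset)
  then have "{1..n} - X \<in> nsets {1..n} 3" by (simp add: nsets_def)
  then obtain p q r where p: "{1..n} - X = {p, q, r}" "p < q" "q < r"
    unfolding ordered_nsets_3_eq by auto
  have m: "p \<in> {1..n}" "r \<in> {1..n}" "r \<noteq> n" using p assms(2) by blast+
  have "X = {1..n} - {p, q, r}" unfolding p(1)[symmetric] using X(1) by blast
  \<comment> \<open>\<open>p < q < r\<close> makes the truncated subtractions exact;
    \<open>r \<noteq> n\<close> later gives \<open>c + 3 \<le> n\<close>.\<close>
  moreover have "q - 1 + 1 = q" "r - 2 + 2 = r" using p(2,3) by auto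
  ultimately have "X = cotriple n p (q - 1) (r - 2)" by (simp only: cotriple_def)
  then show ?thesis using p(2,3) m by (intro that[of p "q - 1" "r - 2"]) auto
qed

text \<open>Raising an element of a set lowers one of its complement, which turns up-closure into
  down-closure of triples.\<close>

lemma insert_Diff_swap:
  assumes "y \<in> S" "x \<noteq> y"
  shows "insert y ((S - A) - {x}) = S - insert x (A - {y})"
  using assms by auto

section \<open>Plane partitions and up-closed families\<close>

lemma tspp_upset_mem_iff:
  assumes "T \<in> tspp m" "m + 3 = n" "1 \<le> a" "a \<le> b" "b \<le> c" "c \<le> m"
  shows "cotriple n a b c \<in> tspp_upset n T \<longleftrightarrow> (a, b, c) \<in> T"
proof
  assume "cotriple n a b c \<in> tspp_upset n T"
  then obtain a' b' c' where "cotriple n a b c = cotriple n a' b' c'" "(a', b', c') \<in> T" "a' \<le> b'" "b' \<le> c'"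
    by (auto simp: tspp_upset_def)
  moreover from this tspp_box[OF assms(1)] have "1 \<le> a'" "c' + 2 \<le> n" using assms(2) by fastforce+
  ultimately show "(a, b, c) \<in> T" using cotriple_inj[of n a b c a' b' c'] assms by auto
qed (use assms(4,5) tspp_upsetI in blast)

lemma tspp_upset_in_upsets:
  assumes T: "T \<in> tspp (n - 3)" and n: "n \<ge> 4"
  shows "tspp_upset n T \<in> upsets n (n - 4)"
proof -
  have k: "Suc (n - 4) = n - 3" using n by simp
  have mem: "X \<in> nsets {1..n} (n - 3)" "n \<in> X" if "X \<in> tspp_upset n T" for X
  proof -
    from that obtain a b c where X: "X = cotriple n a b c" "(a, b, c) \<in> T" "a \<le> b" "b \<le> c"
      unfolding tspp_upset_def by blast
    then have "1 \<le> a" "c + 3 \<le> n" using tspp_box[OF T X(2)] n by auto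
    then show "X \<in> nsets {1..n} (n - 3)" "n \<in> X"
      using X cotriple_mem_nsets[of a b c n] by auto
  qed
  have "up_closed n (tspp_upset n T)"
    unfolding up_closed_def
  proof (intro ballI impI)
    fix X x y assume "X \<in> tspp_upset n T" and x: "x \<in> X" and y: "y \<in> {1..n} - X" and "x < y"
    then obtain a b c where X: "X = cotriple n a b c" and abc: "(a, b, c) \<in> T" "a \<le> b" "b \<le> c"
      by (auto simp: tspp_upset_def)
    note box = tspp_box[OF T abc(1)]
    have x': "1 \<le> x" "x \<noteq> a" "x \<noteq> b + 1" "x \<noteq> c + 2" using x by (auto simp: X cotriple_def)
    have eq: "insert y (X - {x}) = {1..n} - insert x ({a, b + 1, c + 2} - {y})"
      unfolding X cotriple_def using x y \<open>x < y\<close> by (intro insert_Diff_swap) (auto simp: X cotriple_def)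
    have *: "insert y (X - {x}) \<in> tspp_upset n T"
      if "insert x ({a, b + 1, c + 2} - {y}) = {a', b' + 1, c' + 2}" "1 \<le> a'" "a' \<le> b'" "b' \<le> c'"
        "a' \<le> a" "b' \<le> b" "c' \<le> c" for a' b' c'
    proof -
      have "(a', b', c') \<in> T" using tspp_down[OF T abc(1)] that by simp
      then show ?thesis using that unfolding eq tspp_upset_def cotriple_def by auto
    qed
    \<comment> \<open>\<open>x\<close> replaces \<open>y\<close> in the complement. Entries between
      them move up one position, where the shift is larger by one; hence \<open>a - 1\<close> and
      \<open>b - 1\<close>.\<close>
    from y consider "y = a" | "y = b + 1" | "y = c + 2" by (auto simp: X cotriple_def)
    then show "insert y (X - {x}) \<in> tspp_upset n T"
    proof cases
      case 1
      then show ?thesis using \<open>x < y\<close> abc x' by (intro *[of x b c]) auto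
    next
      case 2
      show ?thesis
      proof (cases "x < a")
        case True
        then show ?thesis using 2 \<open>x < y\<close> abc x' by (intro *[of x "a - 1" c]) auto
      next
        case False
        then show ?thesis using 2 \<open>x < y\<close> abc x' box by (intro *[of a "x - 1" c]) auto
      qed
    next
      case 3
      consider "x < a" | "a < x" "x < b + 1" | "b + 1 < x" using x' by linarith
      then show ?thesis
      proof cases
        case 1
        then show ?thesis using 3 \<open>x < y\<close> abc x' by (intro *[of x "a - 1" "b - 1"]) auto
      next
        case 2
        then show ?thesis using 3 \<open>x < y\<close> abc x' box by (intro *[of a "x - 1" "b - 1"]) auto
      next
        case 3
        then show ?thesis using \<open>y = c + 2\<close> \<open>x < y\<close> abc x' box by (intro *[of a b "x - 2"]) auto
      qed
    qed
  qed
  then show ?thesis using mem unfolding upsets_def k by blast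
qed

text \<open>Lowering the coordinates one by one, smallest first, keeps every intermediate triple
  weakly increasing.\<close>

lemma upset_cotriple_mono:
  assumes U: "up_closed n U" and mem: "cotriple n a b c \<in> U"
    and "1 \<le> a'" "a' \<le> b'" "b' \<le> c'" "a' \<le> a" "b' \<le> b" "c' \<le> c" "a \<le> b" "b \<le> c" "c + 3 \<le> n"
  shows "cotriple n a' b' c' \<in> U"
proof -
  have step: "{1..n} - insert x (A - {y}) \<in> U"
    if "{1..n} - A \<in> U" "1 \<le> x" "x < y" "y \<le> n" "x \<notin> A" "y \<in> A" for x y A
  proof -
    have "insert y (({1..n} - A) - {x}) \<in> U"
      using that by (intro up_closedD[OF U]) auto
    then show ?thesis using insert_Diff_swap[of y "{1..n}" x A] that by simp
  qed
  have 1: "cotriple n a' b c \<in> U"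
  proof (cases "a' = a")
    case False
    then have "insert a' ({a, b + 1, c + 2} - {a}) = {a', b + 1, c + 2}" using assms by auto
    then show ?thesis using step[of "{a, b + 1, c + 2}" a' a] assms False unfolding cotriple_def by auto
  qed (use mem in simp)
  have 2: "cotriple n a' b' c \<in> U"
  proof (cases "b' = b")
    case False
    then have "insert (b' + 1) ({a', b + 1, c + 2} - {b + 1}) = {a', b' + 1, c + 2}" using assms by auto
    then show ?thesis using step[of "{a', b + 1, c + 2}" "b' + 1" "b + 1"] assms 1 False
      unfolding cotriple_def by auto
  qed (use 1 in simp)
  show ?thesis
  proof (cases "c' = c")
    case False
    then have "insert (c' + 2) ({a', b' + 1, c + 2} - {c + 2}) = {a', b' + 1, c' + 2}" using assms by auto
    then show ?thesis using step[of "{a', b' + 1, c + 2}" "c' + 2" "c + 2"] assms 2 False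
      unfolding cotriple_def by auto
  qed (use 2 in simp)
qed

text \<open>The arguments of \<open>cotriple\<close> below are \<open>a\<close>, \<open>b\<close>, \<open>c\<close> sorted increasingly.\<close>

definition upset_tspp :: "nat \<Rightarrow> nat set set \<Rightarrow> (nat \<times> nat \<times> nat) set" where
  "upset_tspp n U = {(a, b, c). {a, b, c} \<subseteq> {1..n - 3} \<and>
     cotriple n (min a (min b c)) (max (min a b) (min (max a b) c)) (max a (max b c)) \<in> U}"

text \<open>Minimum, median and maximum are symmetric and monotone in the three coordinates.\<close>

lemma upset_tspp_in_tspp:
  assumes U: "up_closed n U"
  shows "upset_tspp n U \<in> tspp (n - 3)"
proof -
  let ?l = "\<lambda>a b c :: nat. min a (min b c)" and ?m = "\<lambda>a b c :: nat. max (min a b) (min (max a b) c)"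
    and ?h = "\<lambda>a b c :: nat. max a (max b c)"
  have sym: "?l a c b = ?l a b c \<and> ?m a c b = ?m a b c \<and> ?h a c b = ?h a b c"
    "?l b a c = ?l a b c \<and> ?m b a c = ?m a b c \<and> ?h b a c = ?h a b c" for a b c
    by (auto simp: min_def max_def)
  \<comment> \<open>These two transpositions generate all permutations.\<close>
  have sw: "(a, c, b) \<in> upset_tspp n U" "(b, a, c) \<in> upset_tspp n U" if "(a, b, c) \<in> upset_tspp n U" for a b c
    using that by (simp_all add: upset_tspp_def sym[where a = a and b = b and c = c])
  have "(a', b', c') \<in> upset_tspp n U"
    if "(a, b, c) \<in> upset_tspp n U" "a' \<in> {1..a}" "b' \<in> {1..b}" "c' \<in> {1..c}" for a b c a' b' c'
  proof -
    have box: "a \<in> {1..n - 3}" "b \<in> {1..n - 3}" "c \<in> {1..n - 3}"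
      and mem: "cotriple n (?l a b c) (?m a b c) (?h a b c) \<in> U"
      using that(1) by (auto simp: upset_tspp_def)
    have "cotriple n (?l a' b' c') (?m a' b' c') (?h a' b' c') \<in> U"
    proof (rule upset_cotriple_mono[OF U mem])
      show "?m a' b' c' \<le> ?m a b c" using that(2-4) by (intro max.mono min.mono) auto
      show "?l a' b' c' \<le> ?l a b c" "?h a' b' c' \<le> ?h a b c" using that(2-4) by auto
      show "?h a b c + 3 \<le> n" using box by auto
    qed (use that(2-4) in auto)
    then show ?thesis using that(2-4) box by (auto simp: upset_tspp_def)
  qed
  moreover have "upset_tspp n U \<subseteq> {1..n - 3} \<times> {1..n - 3} \<times> {1..n - 3}"
    by (auto simp: upset_tspp_def)
  ultimately show ?thesis using sw unfolding tspp_def mem_Collect_eq by blast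
qed

lemma tspp_upset_upset_tspp:
  assumes U: "U \<in> upsets n (n - 4)" and n: "n \<ge> 4"
  shows "tspp_upset n (upset_tspp n U) = U"
proof (intro equalityI subsetI)
  fix X assume "X \<in> tspp_upset n (upset_tspp n U)"
  then show "X \<in> U"
    by (auto simp: tspp_upset_def upset_tspp_def min_absorb1 max_absorb2)
next
  fix X assume X: "X \<in> U"
  have "Suc (n - 4) = n - 3" using n by simp
  with U X have "X \<in> nsets {1..n} (n - 3)" "n \<in> X" by (auto simp: upsets_def)
  moreover have "n \<ge> 3" using n by simp
  ultimately obtain a b c where "X = cotriple n a b c" "1 \<le> a" "a \<le> b" "b \<le> c" "c + 3 \<le> n"
    by (rule ex_cotriple)
  moreover from this X have "(a, b, c) \<in> upset_tspp n U"
    by (auto simp: upset_tspp_def min_absorb1 max_absorb2)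
  ultimately show "X \<in> tspp_upset n (upset_tspp n U)"
    using tspp_upsetI by blast
qed

lemma tspp_upset_subset_iff:
  assumes T: "T \<in> tspp (n - 3)" "T' \<in> tspp (n - 3)" and n: "n \<ge> 4"
  shows "tspp_upset n T \<subseteq> tspp_upset n T' \<longleftrightarrow> T \<subseteq> T'"
proof
  assume sub: "tspp_upset n T \<subseteq> tspp_upset n T'"
  have sorted: "(a, b, c) \<in> T'" if "(a, b, c) \<in> T" "a \<le> b" "b \<le> c" for a b c
    using that sub tspp_box[OF T(1) that(1)] n
      tspp_upset_mem_iff[OF T(1), of n a b c] tspp_upset_mem_iff[OF T(2), of n a b c] by auto
  note perm = tspp_perm[OF T(1)] tspp_perm[OF T(2)]
  show "T \<subseteq> T'"
  proof (clarify)
    fix a b c assume "(a, b, c) \<in> T"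
    then show "(a, b, c) \<in> T'" using sorted perm by (metis nat_le_linear)
  qed
qed (auto simp: tspp_upset_def)

section \<open>Assembly of the isomorphism\<close>

theorem theorem3:
  fixes n :: nat
  assumes "n \<ge> 5"
  shows "order_isomorphic
    (tspp (n - 3)) (\<subseteq>)
    {C \<in> higher_bruhat n (n - 4).
       deletion_class n (n - 4) C = comm_class (n - 1) (n - 4) (lex_seq (nsets {1..n - 1} (n - 4)))}
    (hb_le n (n - 4))"
proof -
  have n: "n - 4 > 0" "n > 0" "n \<ge> 4" using assms by auto
  let ?f = "\<lambda>T. orders n (n - 4) (tspp_upset n T)"
  have iff: "hb_le n (n - 4) (?f T) (?f T') \<longleftrightarrow> T \<subseteq> T'" if "T \<in> tspp (n - 3)" "T' \<in> tspp (n - 3)" for T T'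
    using that tspp_upset_in_upsets[OF _ n(3)] tspp_upset_subset_iff[OF _ _ n(3)]
      hb_le_imp_subset[OF _ n(1)] subset_imp_hb_le[OF n(1)] by metis
  \<comment> \<open>Equal images are related both ways by reflexivity, so \<open>iff\<close> gives
    both inclusions.\<close>
  have "inj_on ?f (tspp (n - 3))"
  proof (rule inj_onI)
    fix T T' assume T: "T \<in> tspp (n - 3)" "T' \<in> tspp (n - 3)" and "?f T = ?f T'"
    then show "T = T'" using iff[of T T'] iff[of T' T] by (simp add: hb_le_def)
  qed
  moreover have "tspp_upset n ` tspp (n - 3) = upsets n (n - 4)"
  proof (intro equalityI subsetI)
    fix U assume U: "U \<in> upsets n (n - 4)"
    then have "upset_tspp n U \<in> tspp (n - 3)" by (intro upset_tspp_in_tspp) (simp add: upsets_def)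
    then show "U \<in> tspp_upset n ` tspp (n - 3)" using tspp_upset_upset_tspp[OF U n(3)] by (metis imageI)
  qed (use tspp_upset_in_upsets n(3) in blast)
  then have "?f ` tspp (n - 3) = {C \<in> higher_bruhat n (n - 4).
      deletion_class n (n - 4) C = comm_class (n - 1) (n - 4) (lex_seq (nsets {1..n - 1} (n - 4)))}"
    unfolding higher_bruhat_fibre[OF n(1,2)] by (metis image_image)
  ultimately show ?thesis
    using iff unfolding order_isomorphic_def bij_betw_def by (intro exI[of _ ?f]) simp
qed

end
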